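(* Let $(X,d)$ be a metric space, let $F:X\to\overline{\mathbb{R}}$ be a function, and let $F_n:X\to\overline{\mathbb{R}}$ ($n\in\mathbb{N}$) be a sequence of functions. Assume that for every $x\in X$ and every pair of sequences $\{n_k\}\subseteq\mathbb{N}$ and $\{x_k\}\subseteq X$ the following implication holds: if $$n_k\to+\infty,\qquad x_k\to x,\qquad \sup_{k\in\mathbb{N}}\left\{|F_{n_k}(x_k)|+|\nabla F_{n_k}|(x_k)\right\}<+\infty,$$ then $$\lim_{k\to+\infty}F_{n_k}(x_k)=F(x)\qquad\text{and}\qquad \liminf_{k\to+\infty}|\nabla F_{n_k}|(x_k)\ge|\nabla F|(x).$$ Let $T>0$, and for every $n\in\mathbb{N}$ let $(u_n,\psi_n,E_n)$ be a maximal slope curve for $F_n$ in $[0,T]$. Assume that $$\sup_{n\in\mathbb{N}}\ \max_{t\in[0,T]}|\psi_n(t)|<+\infty,$$ and that $\{u_n\}$ has a pointwise limit, namely there exists $u:[0,T]\to X$ such that $$\lim_{n\to+\infty}u_n(t)=u(t)\qquad\forall t\in[0,T].$$ Then there exist $\psi$ and $E$ such that $(u,\psi,E)$ is a maximal slope curve for $F$ in $[0,T]$.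
   Context: $\overline{\mathbb{R}}:=\mathbb{R}\cup\{-\infty,+\infty\}$. Slope: for $F:X\to\overline{\mathbb{R}}$ and $x\in X$, the (descending) slope $|\nabla F|(x)\in[0,+\infty]$ is $+\infty$ if $F(x)\notin\mathbb{R}$, and otherwise $$|\nabla F|(x):=\limsup_{y\to x}\frac{\max\{F(x)-F(y),0\}}{d(x,y)}$$ (limsup over $y\ne x$; it is $0$ if $x$ is isolated). $AC^2([0,T];X)$ is the set of functions $v:[0,T]\to X$ for which there exists $g\in L^2((0,T))$ with $d(v(t),v(s))\le\int_s^tg(\tau)\,d\tau$ for all $0\le s\le t\le T$. There is a smallest such $g$ (up to a.e. equality); it is called the metric derivative of $v$ and denoted $|v'|(t)$. A maximal slope curve for $F:X\to\overline{\mathbb{R}}$ in $[0,T]$ is a triple $(u,\psi,E)$ where: - $u\in AC^2([0,T];X)$; - $\psi:[0,T]\to\mathbb{R}$ is a nonincreasing function such that for every $0\le s\le t\le T$ $$\psi(s)-\psi(t)\ge\frac12\int_s^t|u'|^2(\tau)\,d\tau+\frac12\int_s^t|\nabla F|^2(u(\tau))\,d\tau$$ (the second integral on the right being understood as an upper integral, since measurability of $\tau\mapsto|\nabla F|(u(\tau))$ is not assumed a priori); - $E\subseteq[0,T]$ is a set of Lebesgue measure $0$ such that $\psi(t)=F(u(t))$ for every $t\in[0,T]\setminus E$. *)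

theory Defs
  imports "HOL-Analysis.Analysis"
begin

text \<open>The quotient is taken in \<^typ>\<open>ennreal\<close>, so that the limit superior over the trivial
  filter, i.e. at an isolated point, is \<open>0\<close> (it would be \<open>-\<infinity>\<close> in \<^typ>\<open>ereal\<close>).\<close>

definition slope :: "('a::metric_space \<Rightarrow> ereal) \<Rightarrow> 'a \<Rightarrow> ennreal" where
  "slope F x =
     (if \<bar>F x\<bar> = \<infinity> then \<infinity>
      else Limsup (at x) (\<lambda>y. e2ennreal (max (F x - F y) 0) / ennreal (dist x y)))"

lemma slope_isolated:
  assumes "at x = bot" "\<bar>F x\<bar> \<noteq> \<infinity>"
  shows "slope F x = 0"
  using assms by (simp add: slope_def Limsup_bot bot_ennreal)

definition L2_on :: "real \<Rightarrow> (real \<Rightarrow> real) set" where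
  "L2_on T = {g. g \<in> borel_measurable (lebesgue_on {0<..<T}) \<and>
                 integrable (lebesgue_on {0<..<T}) (\<lambda>\<tau>. (g \<tau>)\<^sup>2)}"

text \<open>Curves on \<open>[0,T]\<close> are total functions whose values outside \<open>[0,T]\<close> are irrelevant.\<close>

definition AC2_bounds :: "real \<Rightarrow> (real \<Rightarrow> 'a::metric_space) \<Rightarrow> (real \<Rightarrow> real) set" where
  "AC2_bounds T v =
     {g \<in> L2_on T. \<forall>s t. 0 \<le> s \<and> s \<le> t \<and> t \<le> T \<longrightarrow>
        dist (v t) (v s) \<le> (\<integral>\<tau>. g \<tau> \<partial>lebesgue_on {s<..<t})}"

definition AC2 :: "real \<Rightarrow> (real \<Rightarrow> 'a::metric_space) set" where
  "AC2 T = {v. AC2_bounds T v \<noteq> {}}"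

text \<open>The a.e. smallest bound. It is determined only up to a null set; \<open>SOME\<close> picks a
  representative, and the definition below uses it only under integrals.\<close>

definition metric_derivative :: "real \<Rightarrow> (real \<Rightarrow> 'a::metric_space) \<Rightarrow> real \<Rightarrow> real" where
  "metric_derivative T v =
     (SOME g. g \<in> AC2_bounds T v \<and>
        (\<forall>h\<in>AC2_bounds T v. AE \<tau> in lebesgue_on {0<..<T}. g \<tau> \<le> h \<tau>))"

text \<open>On non-measurable functions \<^const>\<open>nn_integral\<close> is a lower integral.\<close>

definition upper_nn_integral :: "'b measure \<Rightarrow> ('b \<Rightarrow> ennreal) \<Rightarrow> ennreal" where
  "upper_nn_integral M f =
     (INF h\<in>{h \<in> borel_measurable M. \<forall>x\<in>space M. f x \<le> h x}. \<integral>\<^sup>+x. h x \<partial>M)"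

lemma upper_nn_integral_measurable:
  assumes "f \<in> borel_measurable M"
  shows "upper_nn_integral M f = (\<integral>\<^sup>+x. f x \<partial>M)"
  unfolding upper_nn_integral_def
  by (rule antisym) (auto intro!: INF_lower INF_greatest nn_integral_mono simp: assms)

text \<open>As \<open>\<psi>\<close> is nonincreasing, \<open>\<psi> s - \<psi> t\<close> is not truncated by \<^const>\<open>ennreal\<close>.\<close>

definition maximal_slope_curve ::
  "real \<Rightarrow> ('a::metric_space \<Rightarrow> ereal) \<Rightarrow> (real \<Rightarrow> 'a) \<Rightarrow> (real \<Rightarrow> real) \<Rightarrow> real set \<Rightarrow> bool" where
  "maximal_slope_curve T F u \<psi> E \<longleftrightarrow>
     u \<in> AC2 T \<and>
     antimono_on {0..T} \<psi> \<and>
     (\<forall>s t. 0 \<le> s \<and> s \<le> t \<and> t \<le> T \<longrightarrow>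
        ennreal (\<psi> s - \<psi> t) \<ge>
          (\<integral>\<^sup>+\<tau>. ennreal ((metric_derivative T u \<tau>)\<^sup>2) \<partial>lebesgue_on {s<..<t}) / 2 +
          upper_nn_integral (lebesgue_on {s<..<t}) (\<lambda>\<tau>. (slope F (u \<tau>))\<^sup>2) / 2) \<and>
     E \<subseteq> {0..T} \<and> E \<in> null_sets lebesgue \<and>
     (\<forall>t\<in>{0..T} - E. ereal (\<psi> t) = F (u t))"

end

theory Submission
  imports Defs "HOL-Complex_Analysis.Great_Picard"
begin

text \<open>Along a subsequence the \<open>\<psi>n\<close> converge pointwise to some \<open>\<psi>\<close> (Helly), so it suffices to show that
  both energy terms are lower semicontinuous and that \<open>\<psi> = F \<circ> u\<close> almost everywhere. By Fatou, for
  almost every \<open>\<tau>\<close> the slopes of \<open>Fn n\<close> at \<open>un n \<tau>\<close> are bounded along a further subsequence depending on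
  \<open>\<tau>\<close>; the hypothesis then identifies \<open>F (u \<tau>)\<close> with \<open>\<psi> \<tau>\<close> and bounds \<open>slope F (u \<tau>)\<close>. The kinetic term
  needs a weak \<open>L\<^sup>2\<close> limit of the metric derivatives. Weak compactness is replaced by a minimal-norm
  argument in the convex sets of functions that dominate the increments of a tail of the sequence;
  applied to a constant sequence, the same argument gives a bound of least norm, and it is the a.e.
  least bound because bounds are closed under pointwise minimum.\<close>

text \<open>Serves to bound a quantity by a liminf: show that it is at most every \<open>y\<close>
  strictly above the liminf, working on a subsequence that stays below \<open>y\<close>.\<close>

lemma liminf_less_subseq:
  fixes f :: "nat \<Rightarrow> 'a::complete_linorder"
  assumes "liminf f < y"
  obtains r :: "nat \<Rightarrow> nat" where "strict_mono r" "\<And>n. f (r n) < y"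
proof -
  have "\<exists>\<^sub>F n in sequentially. f n < y"
    using assms Liminf_bounded[of y f sequentially] by (auto simp: frequently_def not_less)
  then have "infinite {n. f n < y}"
    by (simp add: frequently_cofinite flip: cofinite_eq_sequentially)
  then obtain r :: "nat \<Rightarrow> nat" where "strict_mono r" "\<forall>n. r n \<in> {n. f n < y}"
    using infinite_enumerate by blast
  then show ?thesis
    using that by auto
qed

subsection \<open>Square integrable functions\<close>

lemma square_integrable_add:
  fixes f g :: "'a \<Rightarrow> real"
  assumes [measurable]: "f \<in> borel_measurable M" "g \<in> borel_measurable M"
    and "integrable M (\<lambda>x. (f x)\<^sup>2)" "integrable M (\<lambda>x. (g x)\<^sup>2)"
  shows "integrable M (\<lambda>x. (f x + g x)\<^sup>2)"
proof (rule Bochner_Integration.integrable_bound[of M "\<lambda>x. 2 * (f x)\<^sup>2 + 2 * (g x)\<^sup>2"])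
  have "(f x + g x)\<^sup>2 \<le> 2 * (f x)\<^sup>2 + 2 * (g x)\<^sup>2" for x
    using zero_le_power2[of "f x - g x"] by (simp add: power2_eq_square algebra_simps)
  then show "AE x in M. norm ((f x + g x)\<^sup>2) \<le> norm (2 * (f x)\<^sup>2 + 2 * (g x)\<^sup>2)"
    by auto
qed (use assms in auto)

lemma square_integrable_diff:
  fixes f g :: "'a \<Rightarrow> real"
  assumes "f \<in> borel_measurable M" "g \<in> borel_measurable M"
    and "integrable M (\<lambda>x. (f x)\<^sup>2)" "integrable M (\<lambda>x. (g x)\<^sup>2)"
  shows "integrable M (\<lambda>x. (f x - g x)\<^sup>2)"
  using square_integrable_add[of f M "\<lambda>x. - g x"] assms by auto

lemma square_integrable_mult:
  fixes f g :: "'a \<Rightarrow> real"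
  assumes [measurable]: "f \<in> borel_measurable M" "g \<in> borel_measurable M"
    and "integrable M (\<lambda>x. (f x)\<^sup>2)" "integrable M (\<lambda>x. (g x)\<^sup>2)"
  shows "integrable M (\<lambda>x. f x * g x)"
proof (rule Bochner_Integration.integrable_bound[of M "\<lambda>x. (f x)\<^sup>2 + (g x)\<^sup>2"])
  have "\<bar>f x * g x\<bar> \<le> (f x)\<^sup>2 + (g x)\<^sup>2" for x
    using sum_squares_bound[of "\<bar>f x\<bar>" "\<bar>g x\<bar>"]
      mult_nonneg_nonneg[of "\<bar>f x\<bar>" "\<bar>g x\<bar>"]
    by (simp only: abs_mult power2_abs) linarith
  then show "AE x in M. norm (f x * g x) \<le> norm ((f x)\<^sup>2 + (g x)\<^sup>2)"
    by auto
qed (use assms in auto)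

lemma (in finite_measure) square_integrable_imp_integrable:
  fixes f :: "'a \<Rightarrow> real"
  assumes "f \<in> borel_measurable M" "integrable M (\<lambda>x. (f x)\<^sup>2)"
  shows "integrable M f"
  using square_integrable_mult[of f M "\<lambda>_. 1"] assms by simp

text \<open>Pointwise, either \<open>\<bar>f x\<bar> \<le> c\<close>, or
  \<open>\<bar>f x\<bar>\<close> is at most its square divided by \<open>c\<close>. With the free
  parameter \<open>c\<close> this takes the role of the Cauchy-Schwarz inequality.\<close>

lemma (in finite_measure) L1_le_L2:
  fixes f :: "'a \<Rightarrow> real"
  assumes "f \<in> borel_measurable M" "integrable M (\<lambda>x. (f x)\<^sup>2)" and "c > 0"
  shows "(\<integral>x. \<bar>f x\<bar> \<partial>M) \<le> c * measure M (space M) + (\<integral>x. (f x)\<^sup>2 \<partial>M) / c"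
proof -
  have "\<bar>f x\<bar> \<le> c + (f x)\<^sup>2 / c" for x
  proof (cases "\<bar>f x\<bar> \<le> c")
    case True
    then show ?thesis
      using \<open>c > 0\<close> by (intro add_increasing2) auto
  next
    case False
    then have "\<bar>f x\<bar> * c \<le> (f x)\<^sup>2"
      by (metis abs_ge_zero linorder_not_le mult_left_mono order_less_imp_le power2_abs power2_eq_square)
    then have "\<bar>f x\<bar> \<le> (f x)\<^sup>2 / c"
      using \<open>c > 0\<close> by (simp add: pos_le_divide_eq)
    then show ?thesis
      using \<open>c > 0\<close> by linarith
  qed
  then have "(\<integral>x. \<bar>f x\<bar> \<partial>M) \<le> (\<integral>x. c + (f x)\<^sup>2 / c \<partial>M)"
    using assms square_integrable_imp_integrable[OF assms(1,2)] by (intro integral_mono) auto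
  also have "\<dots> = c * measure M (space M) + (\<integral>x. (f x)\<^sup>2 \<partial>M) / c"
    using assms by simp
  finally show ?thesis .
qed

text \<open>In \<open>L1_le_L2\<close>, first fix \<open>c\<close> so small that the measure term is
  below \<open>e / 2\<close>, then let \<open>d\<close> be so small that the quadratic term is at
  most \<open>e / 2\<close>.\<close>

lemma (in finite_measure) L2_small_imp_L1_small:
  fixes e :: real
  assumes "0 < e"
  obtains d where "0 < d"
    "\<And>f :: 'a \<Rightarrow> real. f \<in> borel_measurable M \<Longrightarrow> integrable M (\<lambda>x. (f x)\<^sup>2) \<Longrightarrow>
       (\<integral>x. (f x)\<^sup>2 \<partial>M) \<le> d \<Longrightarrow> (\<integral>x. \<bar>f x\<bar> \<partial>M) < e"
proof -
  \<comment> \<open>Adding 1 to the total measure avoids a zero denominator and makes the inequality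
    for \<open>c * measure M (space M)\<close> strict.\<close>
  define c where "c = (e / 2) / (measure M (space M) + 1)"
  have "c > 0"
    using \<open>0 < e\<close> measure_nonneg[of M "space M"]
    by (auto simp: c_def intro!: divide_pos_pos add_nonneg_pos)
  moreover have "c * (measure M (space M) + 1) = e / 2"
    using measure_nonneg[of M "space M"] unfolding c_def
    by (intro nonzero_eq_divide_eq[THEN iffD1] refl) linarith
  ultimately have c: "c > 0" "c * measure M (space M) < e / 2"
    by (auto simp: distrib_left)
  show ?thesis
  proof (rule that[of "c * (e / 2)"])
    fix f :: "'a \<Rightarrow> real"
    assume f: "f \<in> borel_measurable M" "integrable M (\<lambda>x. (f x)\<^sup>2)"
      and le: "(\<integral>x. (f x)\<^sup>2 \<partial>M) \<le> c * (e / 2)"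
    have "(\<integral>x. (f x)\<^sup>2 \<partial>M) / c \<le> e / 2"
      using le c(1) by (simp add: pos_divide_le_eq mult.commute)
    then show "(\<integral>x. \<bar>f x\<bar> \<partial>M) < e"
      using L1_le_L2[OF f c(1)] c(2) by linarith
  qed (use c(1) \<open>0 < e\<close> in simp)
qed

section \<open>Completeness, minimal norms and convergence in L^2\<close>

lemma integral_parallelogram:
  fixes f g :: "'a \<Rightarrow> real"
  assumes m: "f \<in> borel_measurable M" "g \<in> borel_measurable M"
    and i: "integrable M (\<lambda>x. (f x)\<^sup>2)" "integrable M (\<lambda>x. (g x)\<^sup>2)"
  shows "(\<integral>x. (f x - g x)\<^sup>2 \<partial>M) =
    2 * (\<integral>x. (f x)\<^sup>2 \<partial>M) + 2 * (\<integral>x. (g x)\<^sup>2 \<partial>M) - 4 * (\<integral>x. ((f x + g x) / 2)\<^sup>2 \<partial>M)"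
proof -
  have s: "integrable M (\<lambda>x. (f x + g x)\<^sup>2)"
    by (rule square_integrable_add[OF m i])
  have "(\<integral>x. (f x - g x)\<^sup>2 \<partial>M) = (\<integral>x. (2 * (f x)\<^sup>2 + 2 * (g x)\<^sup>2) - (f x + g x)\<^sup>2 \<partial>M)"
    by (intro Bochner_Integration.integral_cong) (auto simp: power2_eq_square algebra_simps)
  also have "\<dots> = 2 * (\<integral>x. (f x)\<^sup>2 \<partial>M) + 2 * (\<integral>x. (g x)\<^sup>2 \<partial>M) - (\<integral>x. (f x + g x)\<^sup>2 \<partial>M)"
    using i s by simp
  also have "(\<integral>x. (f x + g x)\<^sup>2 \<partial>M) = 4 * (\<integral>x. ((f x + g x) / 2)\<^sup>2 \<partial>M)"
    by (simp add: power_divide)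
  finally show ?thesis .
qed

text \<open>On a finite measure space an L^2 Cauchy sequence is L^1 Cauchy, so a subsequence
  converges almost everywhere. Its limit is the L^2 limit of the whole sequence, because Fatou's
  lemma carries the Cauchy estimate over to it.\<close>

lemma (in finite_measure) L2_complete:
  fixes f :: "nat \<Rightarrow> 'a \<Rightarrow> real"
  assumes m [measurable]: "\<And>n. f n \<in> borel_measurable M"
    and i: "\<And>n. integrable M (\<lambda>x. (f n x)\<^sup>2)"
    and cau: "\<And>e. e > 0 \<Longrightarrow> \<exists>N. \<forall>i\<ge>N. \<forall>j\<ge>N. (\<integral>x. (f i x - f j x)\<^sup>2 \<partial>M) \<le> e"
  obtains g where "g \<in> borel_measurable M" "integrable M (\<lambda>x. (g x)\<^sup>2)"
    "(\<lambda>n. \<integral>x. (f n x - g x)\<^sup>2 \<partial>M) \<longlonglongrightarrow> 0"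
proof -
  have id: "integrable M (\<lambda>x. (f i x - f j x)\<^sup>2)" for i j
    by (rule square_integrable_diff[OF m m i i])
  have L1: "\<exists>N. \<forall>i\<ge>N. \<forall>j\<ge>N. (LINT x|M. norm (f i x - f j x)) < e" if "e > 0" for e
  proof -
    obtain d where d: "0 < d" "\<And>f :: 'a \<Rightarrow> real. f \<in> borel_measurable M \<Longrightarrow>
        integrable M (\<lambda>x. (f x)\<^sup>2) \<Longrightarrow> (\<integral>x. (f x)\<^sup>2 \<partial>M) \<le> d \<Longrightarrow> (\<integral>x. \<bar>f x\<bar> \<partial>M) < e"
      by (rule L2_small_imp_L1_small[OF \<open>e > 0\<close>]) blast
    show ?thesis
      using cau[OF d(1)] d(2)[OF _ id] by fastforce
  qed
  obtain r where r: "strict_mono r" "AE x in M. Cauchy (\<lambda>i. f (r i) x)"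
    using cauchy_L1_AE_cauchy_subseq[of M f, OF square_integrable_imp_integrable[OF m i] L1]
    by blast
  define g where "g x = lim (\<lambda>i. f (r i) x)" for x
  have gm [measurable]: "g \<in> borel_measurable M"
    unfolding g_def by measurable
  have lim: "AE x in M. (\<lambda>i. f (r i) x) \<longlonglongrightarrow> g x"
    using r(2) by eventually_elim (auto simp: g_def Cauchy_convergent_iff convergent_LIMSEQ_iff)
  \<comment> \<open>Keep \<open>n\<close> fixed and let the other index run to infinity along
    \<open>r\<close>; Fatou's lemma yields the same constant \<open>e\<close> for the limit.\<close>
  have bound: "(\<integral>\<^sup>+x. ennreal ((f n x - g x)\<^sup>2) \<partial>M) \<le> ennreal e"
    if N: "\<forall>i\<ge>N. \<forall>j\<ge>N. (\<integral>x. (f i x - f j x)\<^sup>2 \<partial>M) \<le> e" and "n \<ge> N" for n N e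
  proof -
    have "(\<integral>\<^sup>+x. ennreal ((f n x - g x)\<^sup>2) \<partial>M)
        = (\<integral>\<^sup>+x. liminf (\<lambda>k. ennreal ((f n x - f (r k) x)\<^sup>2)) \<partial>M)"
      using lim
    proof (intro nn_integral_cong_AE, eventually_elim)
      case (elim x)
      then have "(\<lambda>k. ennreal ((f n x - f (r k) x)\<^sup>2)) \<longlonglongrightarrow> ennreal ((f n x - g x)\<^sup>2)"
        by (intro tendsto_intros tendsto_ennrealI)
      then show ?case
        by (rule lim_imp_Liminf[OF sequentially_bot, symmetric])
    qed
    also have "\<dots> \<le> liminf (\<lambda>k. \<integral>\<^sup>+x. ennreal ((f n x - f (r k) x)\<^sup>2) \<partial>M)"
      by (intro nn_integral_liminf) measurable
    also have "\<dots> \<le> liminf (\<lambda>k::nat. ennreal e)"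
    proof (intro Liminf_mono eventually_sequentiallyI[of N])
      fix k assume "N \<le> k"
      then have "r k \<ge> N"
        using seq_suble[OF r(1), of k] by simp
      then show "(\<integral>\<^sup>+x. ennreal ((f n x - f (r k) x)\<^sup>2) \<partial>M) \<le> ennreal e"
        using N \<open>n \<ge> N\<close> by (subst nn_integral_eq_integral[OF id]) (auto intro: ennreal_leI)
    qed
    also have "\<dots> = ennreal e"
      by (simp add: Liminf_const)
    finally show ?thesis .
  qed
  have idg: "\<exists>N. \<forall>n\<ge>N. integrable M (\<lambda>x. (f n x - g x)\<^sup>2) \<and> (\<integral>x. (f n x - g x)\<^sup>2 \<partial>M) \<le> e"
    if "e > 0" for e
  proof -
    obtain N where N: "\<forall>i\<ge>N. \<forall>j\<ge>N. (\<integral>x. (f i x - f j x)\<^sup>2 \<partial>M) \<le> e"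
      using cau[OF \<open>e > 0\<close>] by blast
    have "integrable M (\<lambda>x. (f n x - g x)\<^sup>2) \<and> (\<integral>x. (f n x - g x)\<^sup>2 \<partial>M) \<le> e" if "n \<ge> N" for n
    proof
      have b: "(\<integral>\<^sup>+x. ennreal ((f n x - g x)\<^sup>2) \<partial>M) \<le> ennreal e"
        by (rule bound[OF N that])
      show int: "integrable M (\<lambda>x. (f n x - g x)\<^sup>2)"
        using order.strict_trans1[OF b] by (intro integrableI_bounded) auto
      show "(\<integral>x. (f n x - g x)\<^sup>2 \<partial>M) \<le> e"
        using b \<open>e > 0\<close> by (subst (asm) nn_integral_eq_integral[OF int]) auto
    qed
    then show ?thesis by blast
  qed
  obtain N where N: "integrable M (\<lambda>x. (f N x - g x)\<^sup>2)"
    using idg[of 1] by auto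
  \<comment> \<open>Square integrability of \<open>g\<close> comes from writing it as the difference
    of \<open>f N\<close> and \<open>f N - g\<close>.\<close>
  have "integrable M (\<lambda>x. (f N x - (f N x - g x))\<^sup>2)"
    by (intro square_integrable_diff[OF _ _ i N]) auto
  then have gi: "integrable M (\<lambda>x. (g x)\<^sup>2)"
    by simp
  have "(\<lambda>n. \<integral>x. (f n x - g x)\<^sup>2 \<partial>M) \<longlonglongrightarrow> 0"
  proof (rule LIMSEQ_I)
    fix e :: real assume "0 < e"
    then obtain N where "\<forall>n\<ge>N. (\<integral>x. (f n x - g x)\<^sup>2 \<partial>M) \<le> e / 2"
      using idg[of "e / 2"] by auto
    then show "\<exists>N. \<forall>n\<ge>N. norm ((\<integral>x. (f n x - g x)\<^sup>2 \<partial>M) - 0) < e"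
      using \<open>0 < e\<close> by (intro exI[of _ N]) (auto intro: order.strict_trans1)
  qed
  then show ?thesis
    using that gm gi by blast
qed

text \<open>Substitute for weak sequential compactness: elements of nearly minimal norm in \<open>C n\<close> form a
  Cauchy sequence by the parallelogram identity.\<close>

lemma (in finite_measure) L2_decreasing_midpoint_convex:
  fixes C :: "nat \<Rightarrow> ('a \<Rightarrow> real) set"
  assumes L2: "\<And>n f. f \<in> C n \<Longrightarrow> f \<in> borel_measurable M \<and> integrable M (\<lambda>x. (f x)\<^sup>2)"
    and dec: "decseq C"
    and mid: "\<And>n f g. f \<in> C n \<Longrightarrow> g \<in> C n \<Longrightarrow> (\<lambda>x. (f x + g x) / 2) \<in> C n"
    and bdd: "\<And>n. \<exists>f\<in>C n. (\<integral>x. (f x)\<^sup>2 \<partial>M) \<le> K"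
  obtains h g where "\<And>n. h n \<in> C n" "g \<in> borel_measurable M" "integrable M (\<lambda>x. (g x)\<^sup>2)"
    "(\<lambda>n. \<integral>x. (h n x - g x)\<^sup>2 \<partial>M) \<longlonglongrightarrow> 0"
proof -
  define q where "q f = (\<integral>x. (f x)\<^sup>2 \<partial>M)" for f :: "'a \<Rightarrow> real"
  \<comment> \<open>The infima \<open>d n\<close> of the squared norms increase, since the sets
    shrink, and stay below \<open>K\<close>; so they converge, and their differences can control the
    distances between near-minimizers.\<close>
  define d where "d n = Inf (q ` C n)" for n
  have q0: "q f \<ge> 0" for f
    by (simp add: q_def)
  have bb: "bdd_below (q ` C n)" for n
    by (rule bdd_belowI[of _ 0]) (auto simp: q0)
  have ne: "C n \<noteq> {}" for n
    using bdd[of n] by auto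
  have dq: "d n \<le> q f" if "f \<in> C n" for n f
    unfolding d_def using bb that by (auto intro: cInf_lower)
  have d_mono: "d n \<le> d m" if "n \<le> m" for n m
    unfolding d_def using ne bb decseqD[OF dec that] by (intro cInf_superset_mono) auto
  have d_le: "d n \<le> K" for n
    using bdd[of n] dq[of _ n] by (auto simp: q_def intro: order_trans)
  have "\<exists>f\<in>C n. q f < d n + 1 / real (Suc n)" for n
    using cInf_lessD[of "q ` C n" "d n + 1 / real (Suc n)"] ne by (auto simp: d_def)
  then obtain h where h: "\<And>n. h n \<in> C n" "\<And>n. q (h n) < d n + 1 / real (Suc n)"
    by metis
  \<comment> \<open>Both functions lie in \<open>C n\<close>, hence so does their midpoint, whose
    squared norm is then at least \<open>d n\<close>. The parallelogram identity leaves only the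
    excess of the two squared norms over \<open>d n\<close>.\<close>
  have near: "(\<integral>x. (h n x - h m x)\<^sup>2 \<partial>M) \<le> 2 * (d m - d n) + 4 / real (Suc n)" if "n \<le> m" for n m
  proof -
    have hm: "h m \<in> C n"
      using h(1) decseqD[OF dec that] by auto
    have "(\<integral>x. (h n x - h m x)\<^sup>2 \<partial>M) = 2 * q (h n) + 2 * q (h m) - 4 * q (\<lambda>x. (h n x + h m x) / 2)"
      unfolding q_def using L2[OF h(1)] by (intro integral_parallelogram) auto
    also have "\<dots> \<le> 2 * (d n + 1 / real (Suc n)) + 2 * (d m + 1 / real (Suc m)) - 4 * d n"
      using h(2)[of n] h(2)[of m] dq[OF mid[OF h(1) hm]]
      by (intro diff_mono add_mono mult_left_mono) auto
    also have "\<dots> \<le> 2 * (d m - d n) + 4 / real (Suc n)"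
    proof -
      have "1 / real (Suc m) \<le> 1 / real (Suc n)"
        using that by (auto simp: field_simps)
      then show ?thesis by (simp add: algebra_simps)
    qed
    finally show ?thesis .
  qed
  have "convergent d"
    using incseq_convergent[of d K] d_mono d_le unfolding incseq_def convergent_def by metis
  then have "Cauchy d"
    by (rule convergent_Cauchy)
  have cau: "\<exists>N. \<forall>i\<ge>N. \<forall>j\<ge>N. (\<integral>x. (h i x - h j x)\<^sup>2 \<partial>M) \<le> e" if "e > 0" for e
  proof -
    obtain N1 where N1: "\<forall>i\<ge>N1. \<forall>j\<ge>N1. dist (d i) (d j) < e / 4"
      using \<open>Cauchy d\<close> \<open>e > 0\<close> unfolding Cauchy_def by (meson zero_less_divide_iff zero_less_numeral)
    obtain N2 where N2: "4 / real (Suc N2) < e / 2"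
      using reals_Archimedean[of "e / 8"] \<open>e > 0\<close> by (auto simp: field_simps)
    have *: "(\<integral>x. (h i x - h j x)\<^sup>2 \<partial>M) \<le> e" if "i \<ge> max N1 N2" "i \<le> j" for i j
    proof -
      have "4 / real (Suc i) \<le> 4 / real (Suc N2)"
        using that by (auto simp: field_simps)
      moreover have "d j - d i < e / 4"
        using N1[rule_format, of j i] that abs_ge_self[of "d j - d i"]
        unfolding dist_real_def by linarith
      ultimately show ?thesis
        using near[OF \<open>i \<le> j\<close>] N2 by argo
    qed
    have "(\<integral>x. (h i x - h j x)\<^sup>2 \<partial>M) \<le> e" if "i \<ge> max N1 N2" "j \<ge> max N1 N2" for i j
      using *[of i j] *[of j i] that by (cases "i \<le> j") (auto simp: power2_commute)
    then show ?thesis by blast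
  qed
  obtain g where "g \<in> borel_measurable M" "integrable M (\<lambda>x. (g x)\<^sup>2)"
    "(\<lambda>n. \<integral>x. (h n x - g x)\<^sup>2 \<partial>M) \<longlonglongrightarrow> 0"
    using L2_complete[of h] L2[OF h(1)] cau by blast
  then show ?thesis
    using that h(1) by blast
qed

lemma (in finite_measure) L2_tendsto_imp_L1_tendsto:
  fixes f :: "nat \<Rightarrow> 'a \<Rightarrow> real"
  assumes m: "\<And>n. f n \<in> borel_measurable M" "g \<in> borel_measurable M"
    and i: "\<And>n. integrable M (\<lambda>x. (f n x)\<^sup>2)" "integrable M (\<lambda>x. (g x)\<^sup>2)"
    and lim: "(\<lambda>n. \<integral>x. (f n x - g x)\<^sup>2 \<partial>M) \<longlonglongrightarrow> 0"
  shows "(\<lambda>n. \<integral>x. f n x \<partial>M) \<longlonglongrightarrow> (\<integral>x. g x \<partial>M)"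
proof (rule LIMSEQ_I)
  fix e :: real assume "0 < e"
  obtain d where d: "0 < d" "\<And>f :: 'a \<Rightarrow> real. f \<in> borel_measurable M \<Longrightarrow>
      integrable M (\<lambda>x. (f x)\<^sup>2) \<Longrightarrow> (\<integral>x. (f x)\<^sup>2 \<partial>M) \<le> d \<Longrightarrow> (\<integral>x. \<bar>f x\<bar> \<partial>M) < e"
    by (rule L2_small_imp_L1_small[OF \<open>0 < e\<close>]) blast
  obtain N where N: "\<And>n. n \<ge> N \<Longrightarrow> (\<integral>x. (f n x - g x)\<^sup>2 \<partial>M) < d"
    using LIMSEQ_D[OF lim d(1)] by auto
  have "norm ((\<integral>x. f n x \<partial>M) - (\<integral>x. g x \<partial>M)) < e" if "n \<ge> N" for n
  proof -
    have "(\<integral>x. f n x \<partial>M) - (\<integral>x. g x \<partial>M) = (\<integral>x. f n x - g x \<partial>M)"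
      using square_integrable_imp_integrable[OF m(1) i(1)] square_integrable_imp_integrable[OF m(2) i(2)]
      by simp
    then have "norm ((\<integral>x. f n x \<partial>M) - (\<integral>x. g x \<partial>M)) \<le> (\<integral>x. \<bar>f n x - g x\<bar> \<partial>M)"
      by (simp add: integral_abs_bound)
    also have "\<dots> < e"
      using m N[OF that] by (intro d(2) square_integrable_diff i) auto
    finally show ?thesis .
  qed
  then show "\<exists>N. \<forall>n\<ge>N. norm ((\<integral>x. f n x \<partial>M) - (\<integral>x. g x \<partial>M)) < e"
    by blast
qed

text \<open>Instead of the triangle inequality for the norm, a weighted inequality between squares
  is integrated: the weight of \<open>f n\<close> is close to 1, and the large weight
  \<open>1 + 1 / d\<close> multiplies a term tending to 0.\<close>

lemma L2_norm_le_of_tendsto: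
  fixes f :: "nat \<Rightarrow> 'a \<Rightarrow> real"
  assumes m: "\<And>n. f n \<in> borel_measurable M" "g \<in> borel_measurable M"
    and i: "\<And>n. integrable M (\<lambda>x. (f n x)\<^sup>2)" "integrable M (\<lambda>x. (g x)\<^sup>2)"
    and lim: "(\<lambda>n. \<integral>x. (f n x - g x)\<^sup>2 \<partial>M) \<longlonglongrightarrow> 0"
    and le: "\<And>n. (\<integral>x. (f n x)\<^sup>2 \<partial>M) \<le> c n" and c: "c \<longlonglongrightarrow> B"
  shows "(\<integral>x. (g x)\<^sup>2 \<partial>M) \<le> B"
proof (rule field_le_epsilon)
  fix e :: real assume "0 < e"
  have B: "0 \<le> B"
    using order_trans[OF integral_nonneg_AE le] by (intro LIMSEQ_le_const[OF c]) auto
  \<comment> \<open>Chosen so that the surplus \<open>d * B\<close> is at most \<open>e\<close>,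
    also when \<open>B = 0\<close>.\<close>
  define d where "d = e / (B + 1)"
  have d: "d > 0" "d * B \<le> e"
    using \<open>0 < e\<close> B by (auto simp: d_def field_simps)
  have "(\<integral>x. (g x)\<^sup>2 \<partial>M) \<le> (1 + d) * c n + (1 + 1 / d) * (\<integral>x. (f n x - g x)\<^sup>2 \<partial>M)" for n
  proof -
    have pw: "(g x)\<^sup>2 \<le> (1 + d) * (f n x)\<^sup>2 + (1 + 1 / d) * (f n x - g x)\<^sup>2" for x
    proof -
      \<comment> \<open>The difference of the two sides of \<open>pw\<close> is this square divided
        by \<open>d\<close>.\<close>
      have "0 \<le> (d * f n x + (f n x - g x))\<^sup>2 / d"
        using d by simp
      also have "\<dots> = (1 + d) * (f n x)\<^sup>2 + (1 + 1 / d) * (f n x - g x)\<^sup>2 - (g x)\<^sup>2"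
        using d by (simp add: field_simps power2_eq_square)
      finally show ?thesis by simp
    qed
    have d2: "integrable M (\<lambda>x. (f n x - g x)\<^sup>2)"
      by (rule square_integrable_diff[OF m i])
    have "(\<integral>x. (g x)\<^sup>2 \<partial>M) \<le> (\<integral>x. (1 + d) * (f n x)\<^sup>2 + (1 + 1 / d) * (f n x - g x)\<^sup>2 \<partial>M)"
      using i d2 pw by (intro integral_mono) auto
    also have "\<dots> = (1 + d) * (\<integral>x. (f n x)\<^sup>2 \<partial>M) + (1 + 1 / d) * (\<integral>x. (f n x - g x)\<^sup>2 \<partial>M)"
      using i d2 by simp
    also have "\<dots> \<le> (1 + d) * c n + (1 + 1 / d) * (\<integral>x. (f n x - g x)\<^sup>2 \<partial>M)"
      using le d by (intro add_right_mono mult_left_mono) auto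
    finally show ?thesis .
  qed
  moreover have "(\<lambda>n. (1 + d) * c n + (1 + 1 / d) * (\<integral>x. (f n x - g x)\<^sup>2 \<partial>M))
      \<longlonglongrightarrow> (1 + d) * B + (1 + 1 / d) * 0"
    by (intro tendsto_intros lim c)
  ultimately have "(\<integral>x. (g x)\<^sup>2 \<partial>M) \<le> (1 + d) * B + (1 + 1 / d) * 0"
    by (intro LIMSEQ_le_const) auto
  then show "(\<integral>x. (g x)\<^sup>2 \<partial>M) \<le> B + e"
    using d by (simp add: algebra_simps)
qed

text \<open>On a fine tagged division, use the bound by \<open>g\<close> or by \<open>h\<close> on an interval according to which of
  the two is smaller at the tag; Henstock's lemma controls the error.\<close>

lemma diff_le_integral_min:
  fixes f g h :: "real \<Rightarrow> real"
  assumes "a \<le> b"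
    and g: "g integrable_on {a..b}" and h: "h integrable_on {a..b}"
    and gh: "(\<lambda>x. min (g x) (h x)) integrable_on {a..b}"
    and fg: "\<And>x y. a \<le> x \<Longrightarrow> x \<le> y \<Longrightarrow> y \<le> b \<Longrightarrow> f y - f x \<le> integral {x..y} g"
    and fh: "\<And>x y. a \<le> x \<Longrightarrow> x \<le> y \<Longrightarrow> y \<le> b \<Longrightarrow> f y - f x \<le> integral {x..y} h"
  shows "f b - f a \<le> integral {a..b} (\<lambda>x. min (g x) (h x))"
proof (rule field_le_epsilon)
  fix e :: real assume "e > 0"
  then have e3: "e / 3 > 0" by simp
  obtain \<gamma>1 where \<gamma>1: "gauge \<gamma>1"
    "\<And>p. p tagged_partial_division_of cbox a b \<Longrightarrow> \<gamma>1 fine p \<Longrightarrow>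
       (\<Sum>(x,k)\<in>p. norm (measure lborel k *\<^sub>R g x - integral k g)) < e / 3"
    by (rule Henstock_lemma[of g a b "e / 3"]) (use g e3 in \<open>simp_all add: split_beta\<close>)
  obtain \<gamma>2 where \<gamma>2: "gauge \<gamma>2"
    "\<And>p. p tagged_partial_division_of cbox a b \<Longrightarrow> \<gamma>2 fine p \<Longrightarrow>
       (\<Sum>(x,k)\<in>p. norm (measure lborel k *\<^sub>R h x - integral k h)) < e / 3"
    by (rule Henstock_lemma[of h a b "e / 3"]) (use h e3 in \<open>simp_all add: split_beta\<close>)
  have gh': "((\<lambda>x. min (g x) (h x)) has_integral integral {a..b} (\<lambda>x. min (g x) (h x))) (cbox a b)"
    using integrable_integral[OF gh] by simp
  obtain \<gamma>3 where \<gamma>3: "gauge \<gamma>3"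
    "\<And>p. p tagged_division_of cbox a b \<Longrightarrow> \<gamma>3 fine p \<Longrightarrow>
       norm ((\<Sum>(x,k)\<in>p. measure lborel k *\<^sub>R min (g x) (h x)) - integral {a..b} (\<lambda>x. min (g x) (h x))) < e / 3"
    by (rule has_integralD[OF gh' e3]) blast
  \<comment> \<open>One tagged division has to be fine for three gauges: two for the Henstock errors
    of \<open>g\<close> and \<open>h\<close>, one for the Riemann sum of the minimum. Each costs at
    most \<open>e / 3\<close>.\<close>
  have "gauge (\<lambda>x. \<gamma>1 x \<inter> \<gamma>2 x \<inter> \<gamma>3 x)"
    using \<gamma>1(1) \<gamma>2(1) \<gamma>3(1) by (simp add: gauge_Int)
  then obtain p where p: "p tagged_division_of {a..b}" "(\<lambda>x. \<gamma>1 x \<inter> \<gamma>2 x \<inter> \<gamma>3 x) fine p"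
    by (rule fine_division_exists_real)
  have fine: "\<gamma>1 fine p" "\<gamma>2 fine p" "\<gamma>3 fine p"
    using p(2) by (auto simp: fine_Int)
  have pp: "p tagged_partial_division_of cbox a b"
    using p(1) by (simp add: tagged_division_of_def)
  let ?G = "\<lambda>(x,k). norm (measure lborel k *\<^sub>R g x - integral k g)"
  let ?H = "\<lambda>(x,k). norm (measure lborel k *\<^sub>R h x - integral k h)"
  have "f b - f a = (\<Sum>(x,k)\<in>p. f (Sup k) - f (Inf k))"
    by (rule additive_tagged_division_1[symmetric, OF \<open>a \<le> b\<close> p(1)])
  also have "\<dots> \<le> (\<Sum>z\<in>p. (case z of (x,k) \<Rightarrow> measure lborel k *\<^sub>R min (g x) (h x)) + ?G z + ?H z)"
  proof (intro sum_mono)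
    fix z assume "z \<in> p"
    obtain x k where z: "z = (x,k)" by force
    obtain c d where k: "k = {c..d}" "c \<le> d" "a \<le> c" "d \<le> b"
    proof -
      have "x \<in> k" "k \<subseteq> {a..b}" "\<exists>c d. k = cbox c d"
        using tagged_division_ofD(2-4)[OF p(1)] \<open>z \<in> p\<close> z by auto
      then show ?thesis
        using that by fastforce
    qed
    have "f d - f c \<le> measure lborel k *\<^sub>R min (g x) (h x) + ?G z + ?H z"
    proof (cases "g x \<le> h x")
      case True
      have "f d - f c \<le> integral k g"
        unfolding k(1) using k by (intro fg) auto
      also have "\<dots> \<le> measure lborel k *\<^sub>R g x + ?G z"
        unfolding z by (simp add: abs_if mult.commute)
      also have "\<dots> \<le> measure lborel k *\<^sub>R min (g x) (h x) + ?G z + ?H z"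
        using True by (simp add: z min_def)
      finally show ?thesis .
    next
      case False
      have "f d - f c \<le> integral k h"
        unfolding k(1) using k by (intro fh) auto
      also have "\<dots> \<le> measure lborel k *\<^sub>R h x + ?H z"
        unfolding z by (simp add: abs_if mult.commute)
      also have "\<dots> \<le> measure lborel k *\<^sub>R min (g x) (h x) + ?G z + ?H z"
        using False by (simp add: z min_def)
      finally show ?thesis .
    qed
    then show "(case z of (x,k) \<Rightarrow> f (Sup k) - f (Inf k)) \<le>
        (case z of (x,k) \<Rightarrow> measure lborel k *\<^sub>R min (g x) (h x)) + ?G z + ?H z"
      using k by (simp add: z)
  qed
  also have "\<dots> = (\<Sum>(x,k)\<in>p. measure lborel k *\<^sub>R min (g x) (h x)) + sum ?G p + sum ?H p"
    by (simp add: sum.distrib)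
  also have "\<dots> \<le> integral {a..b} (\<lambda>x. min (g x) (h x)) + e"
  proof -
    have "\<bar>(\<Sum>(x,k)\<in>p. measure lborel k *\<^sub>R min (g x) (h x)) - integral {a..b} (\<lambda>x. min (g x) (h x))\<bar> < e / 3"
      using \<gamma>3(2)[of p] p(1) fine(3) by simp
    then show ?thesis
      using \<gamma>1(2)[OF pp fine(1)] \<gamma>2(2)[OF pp fine(2)] by linarith
  qed
  finally show "f b - f a \<le> integral {a..b} (\<lambda>x. min (g x) (h x)) + e" .
qed

subsection \<open>Bounds for the metric derivative\<close>

lemma finite_measure_lebesgue_on_Ioo [simp]: "finite_measure (lebesgue_on {a<..<b::real})"
  by (rule finite_measure_lebesgue_on) simp

lemma lebesgue_on_Ioo_restrict:
  fixes s t :: real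
  assumes "a \<le> s" "t \<le> b"
  shows "lebesgue_on {s<..<t} = restrict_space (lebesgue_on {a<..<b}) {s<..<t}"
proof -
  have "{a<..<b} \<inter> {s<..<t} = {s<..<t}"
    using assms by auto
  then show ?thesis
    by (simp add: restrict_restrict_space)
qed

lemma AE_lebesgue_on_Ioo_mono:
  fixes s t :: real
  assumes "a \<le> s" "t \<le> b" "AE x in lebesgue_on {a<..<b}. P x"
  shows "AE x in lebesgue_on {s<..<t}. P x"
proof -
  have "AE x in lebesgue. x \<in> {a<..<b} \<longrightarrow> P x"
    using assms(3) by (subst (asm) AE_restrict_space_iff) auto
  then show ?thesis
    using assms(1,2) by (subst AE_restrict_space_iff) (auto elim!: eventually_mono)
qed

lemma integrable_lebesgue_on_Ioo_mono:
  fixes f :: "real \<Rightarrow> real"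
  assumes "a \<le> s" "t \<le> b" "integrable (lebesgue_on {a<..<b}) f"
  shows "integrable (lebesgue_on {s<..<t}) f"
proof -
  have "set_integrable lebesgue {a<..<b} f"
    using assms(3) by (simp add: set_integrable_def integrable_restrict_space)
  then have "set_integrable lebesgue {s<..<t} f"
    by (rule set_integrable_subset) (use assms in auto)
  then show ?thesis
    by (simp add: set_integrable_def integrable_restrict_space)
qed

lemma integral_lebesgue_on_Ioo_mono:
  fixes f :: "real \<Rightarrow> real"
  assumes "a \<le> s" "t \<le> b" "integrable (lebesgue_on {a<..<b}) f" "\<And>x. 0 \<le> f x"
  shows "(\<integral>x. f x \<partial>lebesgue_on {s<..<t}) \<le> (\<integral>x. f x \<partial>lebesgue_on {a<..<b})"
proof (rule integral_mono_lebesgue_on_AE[OF assms(3)])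
  show "{s<..<t} \<subseteq> {a<..<b}"
    using assms(1,2) by auto
qed (simp_all add: assms(4))

lemma L2_onD:
  assumes "g \<in> L2_on T" "0 \<le> s" "t \<le> T"
  shows "g \<in> borel_measurable (lebesgue_on {s<..<t})"
    and "integrable (lebesgue_on {s<..<t}) (\<lambda>x. (g x)\<^sup>2)"
    and "integrable (lebesgue_on {s<..<t}) g"
proof -
  show m: "g \<in> borel_measurable (lebesgue_on {s<..<t})"
    using assms by (subst lebesgue_on_Ioo_restrict[OF assms(2,3)])
      (auto simp: L2_on_def intro: measurable_restrict_space1)
  show i: "integrable (lebesgue_on {s<..<t}) (\<lambda>x. (g x)\<^sup>2)"
    using assms by (intro integrable_lebesgue_on_Ioo_mono[of 0 s t T]) (auto simp: L2_on_def)
  show "integrable (lebesgue_on {s<..<t}) g"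
    by (rule finite_measure.square_integrable_imp_integrable[OF finite_measure_lebesgue_on_Ioo m i])
qed

lemma L2_on_min:
  assumes "g \<in> L2_on T" "h \<in> L2_on T"
  shows "(\<lambda>x. min (g x) (h x)) \<in> L2_on T"
proof -
  have m [measurable]: "g \<in> borel_measurable (lebesgue_on {0<..<T})" "h \<in> borel_measurable (lebesgue_on {0<..<T})"
    using assms by (auto simp: L2_on_def)
  have "integrable (lebesgue_on {0<..<T}) (\<lambda>x. (min (g x) (h x))\<^sup>2)"
  proof (rule Bochner_Integration.integrable_bound[of _ "\<lambda>x. (g x)\<^sup>2 + (h x)\<^sup>2"])
    show "integrable (lebesgue_on {0<..<T}) (\<lambda>x. (g x)\<^sup>2 + (h x)\<^sup>2)"
      using assms by (auto simp: L2_on_def)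
    show "AE x in lebesgue_on {0<..<T}. norm ((min (g x) (h x))\<^sup>2) \<le> norm ((g x)\<^sup>2 + (h x)\<^sup>2)"
      by (auto simp: min_def)
  qed auto
  then show ?thesis
    by (simp add: L2_on_def)
qed

lemma L2_on_midpoint:
  assumes "g \<in> L2_on T" "h \<in> L2_on T"
  shows "(\<lambda>x. (g x + h x) / 2) \<in> L2_on T"
proof -
  have "integrable (lebesgue_on {0<..<T}) (\<lambda>x. (g x + h x)\<^sup>2)"
    using assms by (intro square_integrable_add) (simp_all add: L2_on_def)
  then show ?thesis
    using assms by (auto simp: L2_on_def power_divide)
qed

text \<open>For integrable functions the Lebesgue integral over an open interval is the gauge
  integral over its closure, so the estimate obtained from tagged divisions carries over.\<close>

lemma diff_le_lebesgue_integral_min: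
  fixes f g h :: "real \<Rightarrow> real"
  assumes "a \<le> b"
    and g: "integrable (lebesgue_on {a<..<b}) g" and h: "integrable (lebesgue_on {a<..<b}) h"
    and fg: "\<And>x y. a \<le> x \<Longrightarrow> x \<le> y \<Longrightarrow> y \<le> b \<Longrightarrow> f y - f x \<le> (\<integral>\<tau>. g \<tau> \<partial>lebesgue_on {x<..<y})"
    and fh: "\<And>x y. a \<le> x \<Longrightarrow> x \<le> y \<Longrightarrow> y \<le> b \<Longrightarrow> f y - f x \<le> (\<integral>\<tau>. h \<tau> \<partial>lebesgue_on {x<..<y})"
  shows "f b - f a \<le> (\<integral>\<tau>. min (g \<tau>) (h \<tau>) \<partial>lebesgue_on {a<..<b})"
proof -
  have eq: "(\<integral>\<tau>. k \<tau> \<partial>lebesgue_on {x<..<y}) = integral {x..y} k"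
    if "integrable (lebesgue_on {a<..<b}) k" "a \<le> x" "y \<le> b" for k :: "real \<Rightarrow> real" and x y
    using integrable_lebesgue_on_Ioo_mono[OF that(2,3,1)]
    by (simp add: lebesgue_integral_eq_integral integral_open_interval_real)
  have int: "k integrable_on {a..b}" if "integrable (lebesgue_on {a<..<b}) k" for k :: "real \<Rightarrow> real"
    using integrable_on_lebesgue_on[OF that] by (simp add: integrable_on_Icc_iff_Ioo)
  have "f b - f a \<le> integral {a..b} (\<lambda>x. min (g x) (h x))"
    using assms by (intro diff_le_integral_min int) (auto simp flip: eq)
  then show ?thesis
    using g h by (simp add: eq)
qed

lemma AC2_boundsD:
  assumes "g \<in> AC2_bounds T v"
  shows "g \<in> L2_on T"
    and "0 \<le> s \<Longrightarrow> s \<le> t \<Longrightarrow> t \<le> T \<Longrightarrow> dist (v t) (v s) \<le> (\<integral>\<tau>. g \<tau> \<partial>lebesgue_on {s<..<t})"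
  using assms by (auto simp: AC2_bounds_def)

lemma AC2_bounds_min:
  assumes g: "g \<in> AC2_bounds T v" and h: "h \<in> AC2_bounds T v"
  shows "(\<lambda>x. min (g x) (h x)) \<in> AC2_bounds T v"
proof -
  have "dist (v t) (v s) \<le> (\<integral>\<tau>. min (g \<tau>) (h \<tau>) \<partial>lebesgue_on {s<..<t})"
    if st: "0 \<le> s" "s \<le> t" "t \<le> T" for s t
  proof -
    \<comment> \<open>Reduction to a real function: by the triangle inequality the increments of
      \<open>f\<close> are at most those of \<open>v\<close>, and its increment from
      \<open>s\<close> to \<open>t\<close> is exactly \<open>dist (v t) (v s)\<close>.\<close>
    define f where "f x = dist (v x) (v s)" for x
    have f: "f y - f x \<le> dist (v y) (v x)" for x y
      using dist_triangle[of "v y" "v s" "v x"] by (simp add: f_def)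
    have "f t - f s \<le> (\<integral>\<tau>. min (g \<tau>) (h \<tau>) \<partial>lebesgue_on {s<..<t})"
      using st AC2_boundsD[OF g] AC2_boundsD[OF h]
      by (intro diff_le_lebesgue_integral_min L2_onD order_trans[OF f]) auto
    then show ?thesis
      by (simp add: f_def)
  qed
  then show ?thesis
    using AC2_boundsD(1)[OF g] AC2_boundsD(1)[OF h] by (auto simp: AC2_bounds_def L2_on_min)
qed

text \<open>Membership in \<open>AC2_bounds\<close> does not ask for a sign. Both \<open>g\<close>
  and 0 dominate the increments of a constant function, hence so does their minimum; being
  nonpositive with nonnegative integral, it vanishes almost everywhere.\<close>

lemma AC2_bounds_nonneg:
  assumes g: "g \<in> AC2_bounds T v" and "0 \<le> T"
  shows "AE \<tau> in lebesgue_on {0<..<T}. 0 \<le> g \<tau>"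
proof -
  let ?M = "lebesgue_on {0<..<T}"
  have gi: "integrable ?M g"
    using L2_onD(3)[OF AC2_boundsD(1)[OF g], of 0 T] by simp
  have "(0::real) - 0 \<le> (\<integral>\<tau>. min (g \<tau>) 0 \<partial>?M)"
  proof (rule diff_le_lebesgue_integral_min[where f="\<lambda>_. 0"])
    fix x y :: real assume "0 \<le> x" "x \<le> y" "y \<le> T"
    then show "0 - 0 \<le> (\<integral>\<tau>. g \<tau> \<partial>lebesgue_on {x<..<y})"
      using order_trans[OF zero_le_dist AC2_boundsD(2)[OF g]] by simp
  qed (fact \<open>0 \<le> T\<close> gi | simp)+
  moreover have "(\<integral>\<tau>. - min (g \<tau>) 0 \<partial>?M) \<ge> 0"
    by (intro integral_nonneg_AE) auto
  ultimately have "(\<integral>\<tau>. - min (g \<tau>) 0 \<partial>?M) = 0"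
    by simp
  then have "AE \<tau> in ?M. - min (g \<tau>) 0 = 0"
    using gi by (subst (asm) integral_nonneg_eq_0_iff_AE) auto
  then show ?thesis
    by eventually_elim (auto simp: min_def split: if_splits)
qed

text \<open>Provides what a weak limit of the \<open>g n\<close> would give. The energy bound on the
  subinterval is built into the convex sets, so one limit function satisfies it together with the
  increment bounds on all of \<open>{0..T}\<close>; \<open>K\<close> keeps the norms on the whole
  interval bounded.\<close>

lemma AC2_bounds_limit:
  fixes v :: "nat \<Rightarrow> real \<Rightarrow> 'a::metric_space"
  assumes g: "\<And>n. g n \<in> AC2_bounds T (v n)"
    and K: "\<And>n. (\<integral>\<tau>. (g n \<tau>)\<^sup>2 \<partial>lebesgue_on {0<..<T}) \<le> K"
    and lim: "\<And>t. t \<in> {0..T} \<Longrightarrow> (\<lambda>n. v n t) \<longlonglongrightarrow> w t"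
    and ab: "0 \<le> a" "b \<le> T"
    and B: "\<And>n. (\<integral>\<tau>. (g n \<tau>)\<^sup>2 \<partial>lebesgue_on {a<..<b}) \<le> c n"
    and c: "decseq c" "c \<longlonglongrightarrow> B"
  obtains h where "h \<in> AC2_bounds T w" "(\<integral>\<tau>. (h \<tau>)\<^sup>2 \<partial>lebesgue_on {a<..<b}) \<le> B"
proof -
  interpret finite_measure "lebesgue_on {0<..<T}"
    by simp
  \<comment> \<open>The infimum over the tail makes the increment constraint weaker as
    \<open>n\<close> grows, so that the sets increase in strictness no further than
    \<open>g n\<close> allows while their lower bounds still tend to the increments of
    \<open>w\<close>. See \<open>mono\<close> below for the inclusion, which holds for the direction
    required by \<open>decseq C\<close>.\<close>
  define C where "C n = {h \<in> L2_on T.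
      (\<forall>s t. 0 \<le> s \<and> s \<le> t \<and> t \<le> T \<longrightarrow>
        (INF k\<in>{n..}. dist (v k t) (v k s)) \<le> (\<integral>\<tau>. h \<tau> \<partial>lebesgue_on {s<..<t})) \<and>
      (\<integral>\<tau>. (h \<tau>)\<^sup>2 \<partial>lebesgue_on {a<..<b}) \<le> c n}" for n
  have bdd: "bdd_below ((\<lambda>k. dist (v k t) (v k s)) ` S)" for s t S
    by (rule bdd_belowI[of _ 0]) auto
  have CL2: "h \<in> L2_on T" if "h \<in> C n" for h n
    using that by (simp add: C_def)
  have "\<exists>f\<in>C n. (\<integral>\<tau>. (f \<tau>)\<^sup>2 \<partial>lebesgue_on {0<..<T}) \<le> K" for n
  proof (intro bexI[of _ "g n"] K)
    show "g n \<in> C n"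
      using AC2_boundsD[OF g[of n]] B unfolding C_def
      by (auto intro!: cINF_lower2[OF bdd])
  qed
  moreover have "(\<lambda>x. (f x + h x) / 2) \<in> C n" if f: "f \<in> C n" and h: "h \<in> C n" for n f h
  proof -
    have "(INF k\<in>{n..}. dist (v k t) (v k s)) \<le> (\<integral>\<tau>. (f \<tau> + h \<tau>) / 2 \<partial>lebesgue_on {s<..<t})"
      if "0 \<le> s" "s \<le> t" "t \<le> T" for s t
    proof -
      have "(\<integral>\<tau>. (f \<tau> + h \<tau>) / 2 \<partial>lebesgue_on {s<..<t}) =
          ((\<integral>\<tau>. f \<tau> \<partial>lebesgue_on {s<..<t}) + (\<integral>\<tau>. h \<tau> \<partial>lebesgue_on {s<..<t})) / 2"
        using L2_onD(3)[OF CL2[OF f] that(1,3)] L2_onD(3)[OF CL2[OF h] that(1,3)] by simp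
      moreover have "(INF k\<in>{n..}. dist (v k t) (v k s)) \<le> (\<integral>\<tau>. f \<tau> \<partial>lebesgue_on {s<..<t})"
          "(INF k\<in>{n..}. dist (v k t) (v k s)) \<le> (\<integral>\<tau>. h \<tau> \<partial>lebesgue_on {s<..<t})"
        using f h that by (auto simp: C_def)
      ultimately show ?thesis by argo
    qed
    moreover have "(\<integral>\<tau>. ((f \<tau> + h \<tau>) / 2)\<^sup>2 \<partial>lebesgue_on {a<..<b}) \<le> c n"
    proof -
      \<comment> \<open>Convexity of the square, so the energy constraint passes to
        midpoints.\<close>
      have "((f \<tau> + h \<tau>) / 2)\<^sup>2 \<le> ((f \<tau>)\<^sup>2 + (h \<tau>)\<^sup>2) / 2" for \<tau>
        using zero_le_power2[of "f \<tau> - h \<tau>"] by (simp add: power2_eq_square field_simps)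
      then have "(\<integral>\<tau>. ((f \<tau> + h \<tau>) / 2)\<^sup>2 \<partial>lebesgue_on {a<..<b}) \<le>
          (\<integral>\<tau>. ((f \<tau>)\<^sup>2 + (h \<tau>)\<^sup>2) / 2 \<partial>lebesgue_on {a<..<b})"
        using L2_onD(2)[OF L2_on_midpoint[OF CL2[OF f] CL2[OF h]] ab]
          L2_onD(2)[OF CL2[OF f] ab] L2_onD(2)[OF CL2[OF h] ab]
        by (intro integral_mono) auto
      also have "\<dots> = ((\<integral>\<tau>. (f \<tau>)\<^sup>2 \<partial>lebesgue_on {a<..<b}) + (\<integral>\<tau>. (h \<tau>)\<^sup>2 \<partial>lebesgue_on {a<..<b})) / 2"
        using L2_onD(2)[OF CL2[OF f] ab] L2_onD(2)[OF CL2[OF h] ab] by simp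
      also have "\<dots> \<le> c n"
        using f h by (simp add: C_def)
      finally show ?thesis .
    qed
    ultimately show ?thesis
      using L2_on_midpoint[OF CL2[OF f] CL2[OF h]] by (simp add: C_def)
  qed
  moreover have "decseq C"
  proof (rule decseq_SucI, rule subsetI)
    fix n f assume f: "f \<in> C (Suc n)"
    have mono: "(INF k\<in>{n..}. dist (v k t) (v k s)) \<le> (INF k\<in>{Suc n..}. dist (v k t) (v k s))" for s t
      by (intro cINF_superset_mono bdd) auto
    have "c (Suc n) \<le> c n"
      using c(1) by (simp add: decseq_Suc_iff)
    then show "f \<in> C n"
      using f order_trans[OF mono] by (auto simp: C_def)
  qed
  moreover have "f \<in> borel_measurable (lebesgue_on {0<..<T}) \<and> integrable (lebesgue_on {0<..<T}) (\<lambda>x. (f x)\<^sup>2)"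
    if "f \<in> C n" for f n
    using CL2[OF that] by (simp add: L2_on_def)
  ultimately obtain h k where h: "\<And>n. h n \<in> C n"
    and k: "k \<in> borel_measurable (lebesgue_on {0<..<T})" "integrable (lebesgue_on {0<..<T}) (\<lambda>x. (k x)\<^sup>2)"
    and hk: "(\<lambda>n. \<integral>x. (h n x - k x)\<^sup>2 \<partial>lebesgue_on {0<..<T}) \<longlonglongrightarrow> 0"
    using L2_decreasing_midpoint_convex[of C K] by blast
  have kL2: "k \<in> L2_on T"
    using k by (simp add: L2_on_def)
  have hk_sub: "(\<lambda>n. \<integral>x. (h n x - k x)\<^sup>2 \<partial>lebesgue_on {s<..<t}) \<longlonglongrightarrow> 0" if "0 \<le> s" "t \<le> T" for s t
  proof (rule tendsto_sandwich[OF _ _ tendsto_const hk])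
    have "(\<integral>x. (h n x - k x)\<^sup>2 \<partial>lebesgue_on {s<..<t}) \<le> (\<integral>x. (h n x - k x)\<^sup>2 \<partial>lebesgue_on {0<..<T})" for n
      using CL2[OF h, of n] kL2
      by (intro integral_lebesgue_on_Ioo_mono that square_integrable_diff) (auto simp: L2_on_def)
    then show "\<forall>\<^sub>F n in sequentially. (\<integral>x. (h n x - k x)\<^sup>2 \<partial>lebesgue_on {s<..<t}) \<le>
        (\<integral>x. (h n x - k x)\<^sup>2 \<partial>lebesgue_on {0<..<T})"
      by simp
  qed simp
  have "(\<integral>\<tau>. (k \<tau>)\<^sup>2 \<partial>lebesgue_on {a<..<b}) \<le> B"
  proof (rule L2_norm_le_of_tendsto[OF _ _ _ _ hk_sub[OF ab] _ c(2)])
    show "(\<integral>\<tau>. (h n \<tau>)\<^sup>2 \<partial>lebesgue_on {a<..<b}) \<le> c n" for n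
      using h by (simp add: C_def)
  qed (intro L2_onD[OF CL2[OF h] ab] L2_onD[OF kL2 ab])+
  moreover have "dist (w t) (w s) \<le> (\<integral>\<tau>. k \<tau> \<partial>lebesgue_on {s<..<t})"
    if st: "0 \<le> s" "s \<le> t" "t \<le> T" for s t
  proof -
    have "(\<lambda>n. \<integral>\<tau>. h n \<tau> \<partial>lebesgue_on {s<..<t}) \<longlonglongrightarrow> (\<integral>\<tau>. k \<tau> \<partial>lebesgue_on {s<..<t})"
      by (rule finite_measure.L2_tendsto_imp_L1_tendsto[OF _ _ _ _ _ hk_sub[OF st(1,3)]])
        (simp, (rule L2_onD[OF CL2[OF h] st(1,3)] L2_onD[OF kL2 st(1,3)])+)
    moreover have "(\<lambda>n. dist (v n t) (v n s)) \<longlonglongrightarrow> dist (w t) (w s)"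
      using st by (intro tendsto_dist lim) auto
    \<comment> \<open>A number that is eventually below the increments of \<open>v n\<close> is also
      below their tail infima, hence below the integrals of \<open>h n\<close>.\<close>
    moreover have "\<exists>N. \<forall>n\<ge>N. d \<le> (\<integral>\<tau>. h n \<tau> \<partial>lebesgue_on {s<..<t})"
      if d: "\<forall>n\<ge>N. d \<le> dist (v n t) (v n s)" for d N
    proof (intro exI[of _ N] allI impI)
      fix n assume "n \<ge> N"
      then have "d \<le> (INF k\<in>{n..}. dist (v k t) (v k s))"
        using d by (intro cINF_greatest) auto
      also have "\<dots> \<le> (\<integral>\<tau>. h n \<tau> \<partial>lebesgue_on {s<..<t})"
        using h[of n] st by (simp add: C_def)
      finally show "d \<le> (\<integral>\<tau>. h n \<tau> \<partial>lebesgue_on {s<..<t})" .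
    qed
    ultimately have "d \<le> (\<integral>\<tau>. k \<tau> \<partial>lebesgue_on {s<..<t})" if "d < dist (w t) (w s)" for d
      using that order_tendstoD(1)[of "\<lambda>n. dist (v n t) (v n s)" _ sequentially d]
      unfolding eventually_sequentially by (meson LIMSEQ_le_const less_imp_le)
    then show ?thesis
      by (rule dense_le)
  qed
  ultimately show ?thesis
    using kL2 by (intro that[of k]) (simp_all add: AC2_bounds_def)
qed

text \<open>\<open>AC2_bounds_limit\<close> for the constant sequence \<open>v\<close> and a
  minimizing sequence gives a bound \<open>m\<close> of least norm. For any other bound
  \<open>h\<close>, the minimum of \<open>m\<close> and \<open>h\<close> is a bound with nonnegative
  values and no larger square, so minimality forces it to equal \<open>m\<close> almost
  everywhere.\<close>

lemma metric_derivative_works: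
  fixes v :: "real \<Rightarrow> 'a::metric_space"
  assumes "v \<in> AC2 T" "0 \<le> T"
  shows "metric_derivative T v \<in> AC2_bounds T v \<and>
    (\<forall>h\<in>AC2_bounds T v. AE \<tau> in lebesgue_on {0<..<T}. metric_derivative T v \<tau> \<le> h \<tau>)"
proof -
  let ?M = "lebesgue_on {0<..<T}"
  define q where "q g = (\<integral>\<tau>. (g \<tau>)\<^sup>2 \<partial>?M)" for g :: "real \<Rightarrow> real"
  define I where "I = Inf (q ` AC2_bounds T v)"
  have ne: "q ` AC2_bounds T v \<noteq> {}"
    using assms by (simp add: AC2_def)
  have bb: "bdd_below (q ` AC2_bounds T v)"
    by (rule bdd_belowI[of _ 0]) (auto simp: q_def)
  have Iq: "I \<le> q h" if "h \<in> AC2_bounds T v" for h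
    unfolding I_def using bb that by (auto intro: cInf_lower)
  define c where "c n = I + 1 / real (Suc n)" for n
  have "\<exists>g\<in>AC2_bounds T v. q g < c n" for n
    using cInf_lessD[OF ne, of "c n"] by (auto simp: I_def c_def)
  then obtain g where g: "\<And>n. g n \<in> AC2_bounds T v" "\<And>n. q (g n) < c n"
    by metis
  have "decseq c"
    unfolding c_def by (intro decseq_SucI add_left_mono divide_left_mono) auto
  have "c \<longlonglongrightarrow> I + 0"
    unfolding c_def by (intro tendsto_intros LIMSEQ_Suc[OF lim_1_over_n])
  then have "c \<longlonglongrightarrow> I"
    by simp
  have "q (g n) \<le> c 0" for n
    using g(2)[of n] decseqD[OF \<open>decseq c\<close>, of 0 n] by simp
  then obtain m where m: "m \<in> AC2_bounds T v" "q m \<le> I"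
    using AC2_bounds_limit[of g T "\<lambda>_. v" "c 0" v 0 T c I] g less_imp_le[OF g(2)]
      \<open>decseq c\<close> \<open>c \<longlonglongrightarrow> I\<close> unfolding q_def by auto
  have "AE \<tau> in ?M. m \<tau> \<le> h \<tau>" if h: "h \<in> AC2_bounds T v" for h
  proof -
    let ?k = "\<lambda>x. min (m x) (h x)"
    have k: "?k \<in> AC2_bounds T v"
      by (rule AC2_bounds_min[OF m(1) h])
    have ki: "integrable ?M (\<lambda>x. (?k x)\<^sup>2)" and mi: "integrable ?M (\<lambda>x. (m x)\<^sup>2)"
      using L2_onD(2)[OF AC2_boundsD(1)[OF k], of 0 T] L2_onD(2)[OF AC2_boundsD(1)[OF m(1)], of 0 T]
      by auto
    have nn: "AE \<tau> in ?M. 0 \<le> (m \<tau>)\<^sup>2 - (?k \<tau>)\<^sup>2"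
      using AC2_bounds_nonneg[OF k assms(2)] by eventually_elim (auto intro: power_mono)
    have "(\<integral>\<tau>. (m \<tau>)\<^sup>2 - (?k \<tau>)\<^sup>2 \<partial>?M) \<le> 0"
      using Iq[OF k] m(2) ki mi by (simp add: q_def)
    moreover have "(\<integral>\<tau>. (m \<tau>)\<^sup>2 - (?k \<tau>)\<^sup>2 \<partial>?M) \<ge> 0"
      by (rule integral_nonneg_AE[OF nn])
    ultimately have "AE \<tau> in ?M. (m \<tau>)\<^sup>2 - (?k \<tau>)\<^sup>2 = 0"
      using integral_nonneg_eq_0_iff_AE[OF _ nn] ki mi by simp
    then show ?thesis
      using AC2_bounds_nonneg[OF k assms(2)] AC2_bounds_nonneg[OF m(1) assms(2)]
    proof eventually_elim
      case (elim \<tau>)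
      have "(m \<tau>)\<^sup>2 = (?k \<tau>)\<^sup>2"
        using elim(1) by (simp only: right_minus_eq)
      then have "m \<tau> = ?k \<tau>"
        by (rule power2_eq_imp_eq[OF _ elim(3,2)])
      then show ?case by (simp add: min_def split: if_splits)
    qed
  qed
  then show ?thesis
    unfolding metric_derivative_def using m(1)
    by (intro someI[of "\<lambda>g. g \<in> AC2_bounds T v \<and>
        (\<forall>h\<in>AC2_bounds T v. AE \<tau> in ?M. g \<tau> \<le> h \<tau>)" m]) blast
qed

text \<open>The limit bound \<open>h\<close> found for a subinterval depends on that subinterval and
  on the subsequence, but the metric derivative of \<open>w\<close> lies below each such
  \<open>h\<close> almost everywhere.\<close>

lemma AC2_limit:
  fixes v :: "nat \<Rightarrow> real \<Rightarrow> 'a::metric_space"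
  assumes "0 \<le> T" and v: "\<And>n. v n \<in> AC2 T"
    and K: "\<And>n. (\<integral>\<^sup>+\<tau>. ennreal ((metric_derivative T (v n) \<tau>)\<^sup>2) \<partial>lebesgue_on {0<..<T}) \<le> ennreal K"
    and lim: "\<And>t. t \<in> {0..T} \<Longrightarrow> (\<lambda>n. v n t) \<longlonglongrightarrow> w t"
  shows "w \<in> AC2 T"
    and "0 \<le> a \<Longrightarrow> b \<le> T \<Longrightarrow>
      (\<integral>\<^sup>+\<tau>. ennreal ((metric_derivative T w \<tau>)\<^sup>2) \<partial>lebesgue_on {a<..<b}) \<le>
      liminf (\<lambda>n. \<integral>\<^sup>+\<tau>. ennreal ((metric_derivative T (v n) \<tau>)\<^sup>2) \<partial>lebesgue_on {a<..<b})"
proof -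
  define g where "g n = metric_derivative T (v n)" for n
  have g: "g n \<in> AC2_bounds T (v n)" for n
    using metric_derivative_works[OF v \<open>0 \<le> T\<close>] by (simp add: g_def)
  have eq: "(\<integral>\<^sup>+\<tau>. ennreal ((h \<tau>)\<^sup>2) \<partial>lebesgue_on {a<..<b}) = ennreal (\<integral>\<tau>. (h \<tau>)\<^sup>2 \<partial>lebesgue_on {a<..<b})"
    if "h \<in> AC2_bounds T y" "0 \<le> a" "b \<le> T" for h a b and y :: "real \<Rightarrow> 'a"
    by (rule nn_integral_eq_integral[OF L2_onD(2)[OF AC2_boundsD(1)[OF that(1)] that(2,3)]]) simp
  \<comment> \<open>\<open>ennreal\<close> truncates a negative \<open>K\<close> to 0, so the real
    bound must be truncated likewise.\<close>
  define K' where "K' = max K 0"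
  have K': "(\<integral>\<tau>. (g n \<tau>)\<^sup>2 \<partial>lebesgue_on {0<..<T}) \<le> K'" for n
  proof -
    have "ennreal (\<integral>\<tau>. (g n \<tau>)\<^sup>2 \<partial>lebesgue_on {0<..<T}) \<le> ennreal K"
      using K[of n] eq[OF g[of n], of 0 T] by (simp add: g_def)
    also have "\<dots> \<le> ennreal K'"
      by (intro ennreal_leI) (simp add: K'_def)
    finally show ?thesis
      by (simp add: K'_def)
  qed
  obtain h where "h \<in> AC2_bounds T w" "(\<integral>\<tau>. (h \<tau>)\<^sup>2 \<partial>lebesgue_on {0<..<T}) \<le> K'"
    by (rule AC2_bounds_limit[of g T v K' w 0 T "\<lambda>_. K'" K']) (use g K' lim in \<open>auto simp: decseq_def\<close>)
  then show w: "w \<in> AC2 T"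
    by (auto simp: AC2_def)
  assume ab: "0 \<le> a" "b \<le> T"
  let ?A = "\<lambda>n. \<integral>\<^sup>+\<tau>. ennreal ((g n \<tau>)\<^sup>2) \<partial>lebesgue_on {a<..<b}"
  have "(\<integral>\<^sup>+\<tau>. ennreal ((metric_derivative T w \<tau>)\<^sup>2) \<partial>lebesgue_on {a<..<b}) \<le> liminf ?A"
  proof (rule dense_ge)
    fix y assume y: "liminf ?A < y"
    show "(\<integral>\<^sup>+\<tau>. ennreal ((metric_derivative T w \<tau>)\<^sup>2) \<partial>lebesgue_on {a<..<b}) \<le> y"
    proof (cases y)
      case (real B)
      obtain r :: "nat \<Rightarrow> nat" where r: "strict_mono r" "\<And>n. ?A (r n) < y"
        by (rule liminf_less_subseq[OF y]) blast
      have B: "(\<integral>\<tau>. (g (r n) \<tau>)\<^sup>2 \<partial>lebesgue_on {a<..<b}) \<le> B" for n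
        using less_imp_le[OF r(2)[of n]] real by (simp add: eq[OF g ab])
      have rlim: "(\<lambda>n. v (r n) t) \<longlonglongrightarrow> w t" if "t \<in> {0..T}" for t
        using LIMSEQ_subseq_LIMSEQ[OF lim[OF that] r(1)] by (simp add: o_def)
      obtain h where h: "h \<in> AC2_bounds T w" "(\<integral>\<tau>. (h \<tau>)\<^sup>2 \<partial>lebesgue_on {a<..<b}) \<le> B"
        by (rule AC2_bounds_limit[of "\<lambda>n. g (r n)" T "\<lambda>n. v (r n)" K' w a b "\<lambda>_. B" B])
          (use rlim g K' ab B in \<open>auto simp: decseq_def\<close>)
      have md: "metric_derivative T w \<in> AC2_bounds T w"
        "AE \<tau> in lebesgue_on {0<..<T}. metric_derivative T w \<tau> \<le> h \<tau>"
        using metric_derivative_works[OF w \<open>0 \<le> T\<close>] h(1) by auto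
      have "AE \<tau> in lebesgue_on {0<..<T}. (metric_derivative T w \<tau>)\<^sup>2 \<le> (h \<tau>)\<^sup>2"
        using md(2) AC2_bounds_nonneg[OF md(1) \<open>0 \<le> T\<close>] by eventually_elim (rule power_mono)
      then have "AE \<tau> in lebesgue_on {a<..<b}. ennreal ((metric_derivative T w \<tau>)\<^sup>2) \<le> ennreal ((h \<tau>)\<^sup>2)"
        by (intro AE_lebesgue_on_Ioo_mono[OF ab]) (auto elim!: eventually_mono intro: ennreal_leI)
      then have "(\<integral>\<^sup>+\<tau>. ennreal ((metric_derivative T w \<tau>)\<^sup>2) \<partial>lebesgue_on {a<..<b}) \<le>
          (\<integral>\<^sup>+\<tau>. ennreal ((h \<tau>)\<^sup>2) \<partial>lebesgue_on {a<..<b})"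
        by (rule nn_integral_mono_AE)
      also have "\<dots> \<le> y"
        using h(2) real by (simp add: eq[OF h(1) ab] ennreal_leI)
      finally show ?thesis .
    qed simp
  qed
  then show "(\<integral>\<^sup>+\<tau>. ennreal ((metric_derivative T w \<tau>)\<^sup>2) \<partial>lebesgue_on {a<..<b}) \<le>
      liminf (\<lambda>n. \<integral>\<^sup>+\<tau>. ennreal ((metric_derivative T (v n) \<tau>)\<^sup>2) \<partial>lebesgue_on {a<..<b})"
    by (simp add: g_def)
qed

subsection \<open>Upper integrals\<close>

lemma upper_nn_integral_approx:
  assumes "0 < e"
  obtains h where "h \<in> borel_measurable M" "\<And>x. x \<in> space M \<Longrightarrow> f x \<le> h x"
    "(\<integral>\<^sup>+x. h x \<partial>M) \<le> upper_nn_integral M f + e"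
proof (cases "upper_nn_integral M f = \<infinity>")
  case True
  then show ?thesis
    by (intro that[of "\<lambda>_. \<infinity>"]) auto
next
  case False
  then have "upper_nn_integral M f < upper_nn_integral M f + e"
    using assms by (simp add: ennreal_add_left_cancel_less[of _ 0 e, simplified] less_top)
  then show ?thesis
    using that unfolding upper_nn_integral_def by (subst (asm) INF_less_iff) (auto intro: less_imp_le)
qed

text \<open>The definition admits only majorants valid everywhere; raising \<open>h\<close> to
  infinity on the exceptional null set gives one with the same integral.\<close>

lemma upper_nn_integral_le:
  assumes "h \<in> borel_measurable M" "AE x in M. f x \<le> h x"
  shows "upper_nn_integral M f \<le> (\<integral>\<^sup>+x. h x \<partial>M)"
proof -
  obtain N where N: "N \<in> null_sets M" "\<And>x. x \<in> space M - N \<Longrightarrow> f x \<le> h x"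
    using AE_E3[OF assms(2)] by blast
  let ?h = "\<lambda>x. if x \<in> N then \<infinity> else h x"
  have [measurable]: "N \<in> sets M" "h \<in> borel_measurable M"
    using N(1) assms(1) by auto
  have "upper_nn_integral M f \<le> (\<integral>\<^sup>+x. ?h x \<partial>M)"
    unfolding upper_nn_integral_def using N(2) by (intro INF_lower) auto
  also have "\<dots> = (\<integral>\<^sup>+x. h x \<partial>M)"
    using AE_not_in[OF N(1)] by (intro nn_integral_cong_AE) (auto elim!: eventually_mono)
  finally show ?thesis .
qed

text \<open>Replace each \<open>fn n\<close> by a measurable majorant whose integral is within
  \<open>1 / (n + 1)\<close> of the upper integral, and apply the ordinary Fatou lemma to the
  majorants.\<close>

lemma upper_nn_integral_Fatou:
  fixes f :: "'a \<Rightarrow> ennreal"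
  assumes "AE x in M. f x \<le> liminf (\<lambda>n. fn n x)"
  shows "upper_nn_integral M f \<le> liminf (\<lambda>n. upper_nn_integral M (fn n))"
proof -
  have "\<exists>h. h \<in> borel_measurable M \<and> (\<forall>x\<in>space M. fn n x \<le> h x) \<and>
      (\<integral>\<^sup>+x. h x \<partial>M) \<le> upper_nn_integral M (fn n) + ennreal (1 / real (Suc n))" for n
    by (rule upper_nn_integral_approx[of "ennreal (1 / real (Suc n))" M "fn n"]) auto
  then obtain h where h [measurable]: "\<And>n. h n \<in> borel_measurable M"
    and fh: "\<And>n x. x \<in> space M \<Longrightarrow> fn n x \<le> h n x"
    and hi: "\<And>n. (\<integral>\<^sup>+x. h n x \<partial>M) \<le> upper_nn_integral M (fn n) + ennreal (1 / real (Suc n))"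
    by metis
  have "upper_nn_integral M f \<le> (\<integral>\<^sup>+x. liminf (\<lambda>n. h n x) \<partial>M)"
  proof (rule upper_nn_integral_le)
    show "AE x in M. f x \<le> liminf (\<lambda>n. h n x)"
      using assms AE_space
    proof eventually_elim
      case (elim x)
      have "liminf (\<lambda>n. fn n x) \<le> liminf (\<lambda>n. h n x)"
        using fh[OF elim(2)] by (intro Liminf_mono always_eventually) auto
      then show ?case
        using elim(1) by (rule order_trans[rotated])
    qed
  qed measurable
  also have "\<dots> \<le> liminf (\<lambda>n. \<integral>\<^sup>+x. h n x \<partial>M)"
    by (rule nn_integral_liminf) measurable
  also have "\<dots> \<le> liminf (\<lambda>n. upper_nn_integral M (fn n))"
  proof (rule dense_ge)
    fix y assume "liminf (\<lambda>n. upper_nn_integral M (fn n)) < y"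
    then obtain z where z: "liminf (\<lambda>n. upper_nn_integral M (fn n)) < z" "z < y"
      using dense by blast
    obtain r :: "nat \<Rightarrow> nat" where r: "strict_mono r" "\<And>n. upper_nn_integral M (fn (r n)) < z"
      by (rule liminf_less_subseq[OF z(1)]) blast
    have "liminf (\<lambda>n. \<integral>\<^sup>+x. h n x \<partial>M) \<le> liminf (\<lambda>n. \<integral>\<^sup>+x. h (r n) x \<partial>M)"
      using liminf_subseq_mono[OF r(1), of "\<lambda>n. \<integral>\<^sup>+x. h n x \<partial>M"] by (simp add: o_def)
    also have "\<dots> \<le> liminf (\<lambda>n. z + ennreal (1 / real (Suc n)))"
    proof (intro Liminf_mono always_eventually allI)
      fix n
      \<comment> \<open>Since \<open>r n\<close> is at least \<open>n\<close>, the approximation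
        error still vanishes along the subsequence.\<close>
      have "1 / real (Suc (r n)) \<le> 1 / real (Suc n)"
        using seq_suble[OF r(1), of n] by (intro divide_left_mono) auto
      then show "(\<integral>\<^sup>+x. h (r n) x \<partial>M) \<le> z + ennreal (1 / real (Suc n))"
        using r(2)[of n] by (intro order_trans[OF hi] add_mono ennreal_leI) auto
    qed
    also have "\<dots> = z + ennreal 0"
      by (intro lim_imp_Liminf tendsto_intros tendsto_ennrealI LIMSEQ_Suc[OF lim_1_over_n]) auto
    finally show "liminf (\<lambda>n. \<integral>\<^sup>+x. h n x \<partial>M) \<le> y"
      using z(2) by simp
  qed
  finally show ?thesis .
qed

lemma AE_finite_of_upper_nn_integral:
  assumes "upper_nn_integral M f < \<infinity>"
  shows "AE x in M. f x < \<infinity>"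
proof -
  obtain h where h: "h \<in> borel_measurable M" "\<And>x. x \<in> space M \<Longrightarrow> f x \<le> h x"
    "(\<integral>\<^sup>+x. h x \<partial>M) \<le> upper_nn_integral M f + 1"
    by (rule upper_nn_integral_approx[of 1 M f]) auto
  have "(\<integral>\<^sup>+x. h x \<partial>M) < \<infinity>"
    using assms by (intro order.strict_trans1[OF h(3)]) (simp add: less_top)
  then have "AE x in M. h x \<noteq> \<infinity>"
    using nn_integral_PInf_AE[OF h(1)] by auto
  then show ?thesis
    using AE_space by eventually_elim (auto simp: less_top intro: order.strict_trans1[OF h(2)])
qed

lemma power2_less_ennreal_imp_le:
  fixes x :: ennreal
  assumes "x\<^sup>2 < ennreal B"
  shows "x \<le> ennreal (sqrt B)"
proof (cases x)
  case (real r)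
  then have "r\<^sup>2 < B"
    using assms by (simp add: ennreal_power ennreal_less_iff)
  then show ?thesis
    using real by (simp add: ennreal_leI real_le_rsqrt)
qed (use assms in \<open>simp add: power2_eq_square ennreal_top_mult\<close>)

text \<open>Each liminf is the limit of its tail infima, whose half sum at \<open>n\<close> is at
  most \<open>c n\<close>. This passes the energy inequality to the limit.\<close>

lemma half_add_le_of_liminf:
  fixes A B :: "nat \<Rightarrow> ennreal"
  assumes "a \<le> liminf A" "b \<le> liminf B" "\<And>n. A n / 2 + B n / 2 \<le> c n" "c \<longlonglongrightarrow> l"
  shows "a / 2 + b / 2 \<le> l"
proof -
  have inc: "(\<lambda>n. INF m\<in>{n..}. f m) \<longlonglongrightarrow> liminf f" for f :: "nat \<Rightarrow> ennreal"
    unfolding liminf_SUP_INF by (intro LIMSEQ_SUP incseq_SucI INF_superset_mono) auto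
  have "a / 2 + b / 2 \<le> liminf A / 2 + liminf B / 2"
    using assms(1,2) by (intro add_mono divide_right_mono_ennreal)
  also have "\<dots> \<le> l"
  proof (rule LIMSEQ_le[OF _ assms(4)])
    show "(\<lambda>n. (INF m\<in>{n..}. A m) / 2 + (INF m\<in>{n..}. B m) / 2) \<longlonglongrightarrow> liminf A / 2 + liminf B / 2"
      unfolding divide_ennreal_def mult.commute[of _ "inverse 2"]
      by (intro tendsto_add ennreal_tendsto_cmult inc) (auto simp: less_top[symmetric])
    have "(INF m\<in>{n..}. A m) / 2 + (INF m\<in>{n..}. B m) / 2 \<le> c n" for n
      by (intro order_trans[OF _ assms(3)] add_mono divide_right_mono_ennreal INF_lower) auto
    then show "\<exists>N. \<forall>n\<ge>N. (INF m\<in>{n..}. A m) / 2 + (INF m\<in>{n..}. B m) / 2 \<le> c n"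
      by blast
  qed
  finally show ?thesis .
qed

subsection \<open>Limits of maximal slope curves\<close>

text \<open>Pass first to a subsequence converging on the rationals, then to one converging also at the
  countably many discontinuities of the upper limit; elsewhere monotonicity squeezes.\<close>

lemma Helly_selection_antimono:
  fixes f :: "nat \<Rightarrow> real \<Rightarrow> real"
  assumes anti: "\<And>n. antimono_on {a..b} (f n)"
    and bdd: "\<And>n t. t \<in> {a..b} \<Longrightarrow> \<bar>f n t\<bar> \<le> K"
  obtains r where "strict_mono r" "\<And>t. t \<in> {a..b} \<Longrightarrow> convergent (\<lambda>n. f (r n) t)"
proof -
  \<comment> \<open>The endpoints are included so that every remaining point is interior and has
    rationals on both sides.\<close>
  let ?D = "{a..b} \<inter> (\<rat> \<union> {a, b})"
  have "countable ?D"
    by (intro countable_Int2 countable_Un countable_rat) auto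
  then obtain r where r: "strict_mono r" "\<And>t. t \<in> ?D \<Longrightarrow> \<exists>l. (\<lambda>n. f (r n) t) \<longlonglongrightarrow> l"
    using function_convergent_subsequence[of ?D f K] bdd by (metis Int_iff real_norm_def)
  define G where "G t = real_of_ereal (limsup (\<lambda>n. ereal (f (r n) t)))" for t
  have G: "ereal (G t) = limsup (\<lambda>n. ereal (f (r n) t))" if "t \<in> {a..b}" for t
  proof -
    have "limsup (\<lambda>n. ereal (f (r n) t)) \<le> ereal K"
      using bdd[OF that] by (intro Limsup_bounded always_eventually) (auto simp: abs_le_iff)
    moreover have "ereal (- K) \<le> liminf (\<lambda>n. ereal (f (r n) t))"
      using bdd[OF that] by (intro Liminf_bounded always_eventually) (auto simp: abs_le_iff minus_le_iff)
    ultimately have "\<bar>limsup (\<lambda>n. ereal (f (r n) t))\<bar> \<noteq> \<infinity>"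
      using Liminf_le_Limsup[of sequentially "\<lambda>n. ereal (f (r n) t)"]
      by (cases "limsup (\<lambda>n. ereal (f (r n) t))"; cases "liminf (\<lambda>n. ereal (f (r n) t))") auto
    then show ?thesis
      by (simp add: G_def ereal_real)
  qed
  have le: "f n t \<le> f n s" if "s \<in> {a..b}" "t \<in> {a..b}" "s \<le> t" for n s t
    using anti[of n] that by (auto simp: monotone_on_def)
  have Gconv: "(\<lambda>n. f (r n) t) \<longlonglongrightarrow> G t" if t: "t \<in> ?D" for t
  proof -
    obtain l where l: "(\<lambda>n. f (r n) t) \<longlonglongrightarrow> l"
      using r(2)[OF t] by blast
    then have "limsup (\<lambda>n. ereal (f (r n) t)) = ereal l"
      by (intro lim_imp_Limsup) auto
    then show ?thesis
      using l G[of t] t by simp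
  qed
  have "mono_on {a..b} (\<lambda>t. - G t)"
  proof (rule mono_onI)
    fix s t assume st: "s \<in> {a..b}" "t \<in> {a..b}" "s \<le> t"
    have "ereal (G t) \<le> ereal (G s)"
      unfolding G[OF st(1)] G[OF st(2)] using le[OF st] by (intro Limsup_mono always_eventually) auto
    then show "- G s \<le> - G t" by simp
  qed
  then have Ganti: "G t \<le> G s" if "s \<in> {a..b}" "t \<in> {a..b}" "s \<le> t" for s t
    using that by (auto simp: monotone_on_def)
  \<comment> \<open>The negative of \<open>G\<close> is increasing, so its discontinuities are
    countable.\<close>
  define B where "B = {t \<in> {a..b}. \<not> continuous (at t within {a..b}) (\<lambda>t. - G t)}"
  have "countable B"
    unfolding B_def by (rule mono_on_ctble_discont) fact
  then obtain q where q: "strict_mono q" "\<And>t. t \<in> B \<Longrightarrow> \<exists>l. (\<lambda>n. f (r (q n)) t) \<longlonglongrightarrow> l"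
    using function_convergent_subsequence[of B "\<lambda>n. f (r n)" K] bdd by (auto simp: B_def)
  have "convergent (\<lambda>n. f (r (q n)) t)" if t: "t \<in> {a..b}" for t
  proof (cases "t \<in> B \<union> ?D")
    case True
    then show ?thesis
      using q(2) LIMSEQ_subseq_LIMSEQ[OF Gconv[of t] q(1)] by (auto simp: convergent_def o_def)
  next
    case False
    then have ab: "a < t" "t < b"
      using t by (auto simp: less_le)
    have "continuous (at t within {a..b}) (\<lambda>t. - G t)"
      using False t by (simp add: B_def)
    then have cont: "isCont G t"
      using at_within_interior[of t "{a..b}"] ab continuous_minus[of "at t" "\<lambda>t. - G t"] by simp
    have "(\<lambda>n. f (r n) t) \<longlonglongrightarrow> G t"
    proof (rule LIMSEQ_I)
      fix e :: real assume "0 < e"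
      then obtain d where d: "d > 0" "\<And>x. dist x t < d \<Longrightarrow> dist (G x) (G t) < e / 2"
        using cont[unfolded continuous_at_eps_delta, rule_format, of "e / 2"]
        by (auto simp: dist_real_def)
      \<comment> \<open>Rationals on both sides of \<open>t\<close>, close enough that
        \<open>G\<close> changes by less than \<open>e / 2\<close>; monotonicity puts
        \<open>f (r n) t\<close> between the values at \<open>y\<close> and
        \<open>x\<close>.\<close>
      obtain x where x: "x \<in> \<rat>" "max a (t - d) < x" "x < t"
        using Rats_dense_in_real[of "max a (t - d)" t] ab d(1) by auto
      obtain y where y: "y \<in> \<rat>" "t < y" "y < min b (t + d)"
        using Rats_dense_in_real[of t "min b (t + d)"] ab d(1) by auto
      have xD: "x \<in> ?D" and yD: "y \<in> ?D"
        using x y ab by auto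
      obtain N1 where N1: "\<And>n. n \<ge> N1 \<Longrightarrow> norm (f (r n) x - G x) < e / 2"
        using LIMSEQ_D[OF Gconv[OF xD], of "e / 2"] \<open>0 < e\<close> by auto
      obtain N2 where N2: "\<And>n. n \<ge> N2 \<Longrightarrow> norm (f (r n) y - G y) < e / 2"
        using LIMSEQ_D[OF Gconv[OF yD], of "e / 2"] \<open>0 < e\<close> by auto
      have "norm (f (r n) t - G t) < e" if "n \<ge> max N1 N2" for n
      proof -
        have "f (r n) t \<le> f (r n) x" "f (r n) y \<le> f (r n) t"
          using x y ab by (auto intro!: le)
        moreover have "\<bar>G x - G t\<bar> < e / 2" "\<bar>G y - G t\<bar> < e / 2"
          using d(2)[of x] d(2)[of y] x y by (auto simp: dist_real_def)
        moreover have "\<bar>f (r n) x - G x\<bar> < e / 2" "\<bar>f (r n) y - G y\<bar> < e / 2"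
          using N1[of n] N2[of n] that by auto
        ultimately show ?thesis
          unfolding real_norm_def by argo
      qed
      then show "\<exists>N. \<forall>n\<ge>N. norm (f (r n) t - G t) < e"
        by blast
    qed
    then show ?thesis
      using LIMSEQ_subseq_LIMSEQ[OF _ q(1), of "\<lambda>n. f (r n) t"] by (auto simp: convergent_def o_def)
  qed
  then show ?thesis
    using that[of "r \<circ> q"] strict_mono_o[OF r(1) q(1)] by (simp add: o_def)
qed

lemma le_of_half_le_ennreal:
  assumes "x / 2 \<le> ennreal c"
  shows "x \<le> ennreal (2 * c)"
proof (cases x)
  case (real r)
  show ?thesis
  proof (cases "0 \<le> c")
    case True
    then show ?thesis
      using assms real by (simp add: ennreal_divide_numeral ennreal_le_iff ennreal_leI)
  next
    case False
    then have "ennreal (r / 2) \<le> 0"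
      using assms real by (simp add: ennreal_divide_numeral ennreal_neg)
    then show ?thesis
      using real by simp
  qed
qed (use assms in \<open>simp add: ennreal_top_divide top_unique\<close>)

theorem theorem3p1:
  fixes F :: "'a::metric_space \<Rightarrow> ereal"
    and Fn :: "nat \<Rightarrow> 'a \<Rightarrow> ereal"
    and T :: real
    and un :: "nat \<Rightarrow> real \<Rightarrow> 'a" and \<psi>n :: "nat \<Rightarrow> real \<Rightarrow> real" and En :: "nat \<Rightarrow> real set"
    and u :: "real \<Rightarrow> 'a"
  assumes "\<And>(x::'a) (nk :: nat \<Rightarrow> nat) (xk :: nat \<Rightarrow> 'a).
      filterlim nk at_top sequentially \<Longrightarrow>
      xk \<longlonglongrightarrow> x \<Longrightarrow>
      (SUP k. \<bar>Fn (nk k) (xk k)\<bar> + enn2ereal (slope (Fn (nk k)) (xk k))) < \<infinity> \<Longrightarrow>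
      (\<lambda>k. Fn (nk k) (xk k)) \<longlonglongrightarrow> F x \<and>
      liminf (\<lambda>k. slope (Fn (nk k)) (xk k)) \<ge> slope F x"
    and "T > 0"
    and "\<And>n. maximal_slope_curve T (Fn n) (un n) (\<psi>n n) (En n)"
    and "(SUP n. SUP t\<in>{0..T}. ereal \<bar>\<psi>n n t\<bar>) < \<infinity>"
    and "\<And>t. t \<in> {0..T} \<Longrightarrow> (\<lambda>n. un n t) \<longlonglongrightarrow> u t"
  shows "\<exists>\<psi> E. maximal_slope_curve T F u \<psi> E"
proof -
  note curve = assms(3)[unfolded maximal_slope_curve_def]
  have AC: "un n \<in> AC2 T" and anti: "antimono_on {0..T} (\<psi>n n)"
    and En: "En n \<in> null_sets lebesgue"
    and Fn_eq: "\<And>t. t \<in> {0..T} - En n \<Longrightarrow> Fn n (un n t) = ereal (\<psi>n n t)" for n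
    using curve[of n] by auto
  define A where "A n s t =
    (\<integral>\<^sup>+\<tau>. ennreal ((metric_derivative T (un n) \<tau>)\<^sup>2) \<partial>lebesgue_on {s<..<t})" for n s t
  define B where "B n s t =
    upper_nn_integral (lebesgue_on {s<..<t}) (\<lambda>\<tau>. (slope (Fn n) (un n \<tau>))\<^sup>2)" for n s t
  have energy: "A n s t / 2 + B n s t / 2 \<le> ennreal (\<psi>n n s - \<psi>n n t)"
    if "0 \<le> s" "s \<le> t" "t \<le> T" for n s t
    using curve[of n] that by (simp add: A_def B_def)

  \<comment> \<open>Uniform bounds and extraction of a subsequence\<close>
  define S where "S = (SUP n. SUP t\<in>{0..T}. ereal \<bar>\<psi>n n t\<bar>)"
  have S: "ereal \<bar>\<psi>n n t\<bar> \<le> S" if "t \<in> {0..T}" for n t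
    unfolding S_def using that by (intro SUP_upper2[of n] SUP_upper) auto
  have "0 \<le> S"
    using S[of 0 0] \<open>T > 0\<close> by (intro order_trans[OF _ S[of 0 0]]) auto
  then obtain K where K: "S = ereal K"
    using assms(4) by (cases S) (auto simp: S_def)
  have \<psi>K: "\<bar>\<psi>n n t\<bar> \<le> K" if "t \<in> {0..T}" for n t
    using S[OF that, of n] by (simp add: K)
  obtain r where r: "strict_mono r" "\<And>t. t \<in> {0..T} \<Longrightarrow> convergent (\<lambda>n. \<psi>n (r n) t)"
    by (rule Helly_selection_antimono[of 0 T \<psi>n K]) (use anti \<psi>K in auto)
  define \<psi> where "\<psi> t = lim (\<lambda>n. \<psi>n (r n) t)" for t
  have \<psi>: "(\<lambda>n. \<psi>n (r n) t) \<longlonglongrightarrow> \<psi> t" if "t \<in> {0..T}" for t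
    using r(2)[OF that] by (simp add: \<psi>_def convergent_LIMSEQ_iff)
  have ulim: "(\<lambda>n. un (r n) t) \<longlonglongrightarrow> u t" if "t \<in> {0..T}" for t
    using LIMSEQ_subseq_LIMSEQ[OF assms(5)[OF that] r(1)] by (simp add: o_def)

  \<comment> \<open>The total drop of each \<open>\<psi>n n\<close> is at most \<open>2 * K\<close>;
    the other factor 2 undoes the halving in the energy inequality.\<close>
  have bound: "A n 0 T \<le> ennreal (2 * (2 * K))" "B n 0 T \<le> ennreal (2 * (2 * K))" for n
  proof -
    have "ennreal (\<psi>n n 0 - \<psi>n n T) \<le> ennreal (2 * K)"
      using \<psi>K[of 0 n] \<psi>K[of T n] \<open>T > 0\<close> by (intro ennreal_leI) auto
    then have le: "A n 0 T / 2 + B n 0 T / 2 \<le> ennreal (2 * K)"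
      using energy[of 0 T n] \<open>T > 0\<close> by (auto intro: order_trans)
    show "A n 0 T \<le> ennreal (2 * (2 * K))" "B n 0 T \<le> ennreal (2 * (2 * K))"
      by (rule le_of_half_le_ennreal, rule order_trans[OF _ le], simp add: add_increasing add_increasing2)+
  qed

  \<comment> \<open>Pointwise identification of \<open>F\<close> and its slope along the limit
    curve\<close>
  define L where "L \<tau> = liminf (\<lambda>n. (slope (Fn (r n)) (un (r n) \<tau>))\<^sup>2)" for \<tau>
  define N where "N = (\<Union>n. En n)"
  have N: "N \<in> null_sets lebesgue"
    unfolding N_def by (rule null_sets_UN) (rule En)
  \<comment> \<open>Any \<open>c\<close> above the liminf yields a subsequence, depending on the
    time, with bounded slopes; as the values equal those of \<open>\<psi>n\<close>, the
    compatibility hypothesis applies. Keeping \<open>c\<close> arbitrary also gives the sharp slope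
    bound in \<open>slope_le\<close>.\<close>
  have point: "F (u \<tau>) = ereal (\<psi> \<tau>) \<and> (slope F (u \<tau>))\<^sup>2 \<le> ennreal c"
    if \<tau>: "\<tau> \<in> {0..T} - N" and L: "L \<tau> < ennreal c" for \<tau> c
  proof -
    have c: "0 < c"
      using L by (metis ennreal_eq_0_iff linorder_not_less zero_le)
    obtain q :: "nat \<Rightarrow> nat" where q: "strict_mono q"
      "\<And>n. (slope (Fn (r (q n))) (un (r (q n)) \<tau>))\<^sup>2 < ennreal c"
      using L unfolding L_def by (rule liminf_less_subseq) blast
    let ?nk = "\<lambda>k. r (q k)" and ?xk = "\<lambda>k. un (r (q k)) \<tau>"
    have sl: "slope (Fn (?nk k)) (?xk k) \<le> ennreal (sqrt c)" for k
      by (rule power2_less_ennreal_imp_le[OF q(2)])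
    have nk: "strict_mono ?nk"
      using strict_mono_o[OF r(1) q(1)] by (simp add: o_def)
    have xk: "?xk \<longlonglongrightarrow> u \<tau>"
      using LIMSEQ_subseq_LIMSEQ[OF ulim q(1)] \<tau> by (simp add: o_def)
    have Feq: "Fn (?nk k) (?xk k) = ereal (\<psi>n (?nk k) \<tau>)" for k
      using \<tau> by (intro Fn_eq) (auto simp: N_def)
    have "\<bar>Fn (?nk k) (?xk k)\<bar> + enn2ereal (slope (Fn (?nk k)) (?xk k)) \<le> ereal K + ereal (sqrt c)" for k
    proof (rule add_mono)
      show "\<bar>Fn (?nk k) (?xk k)\<bar> \<le> ereal K"
        using \<psi>K[of \<tau>] \<tau> by (simp add: Feq)
      have "enn2ereal (slope (Fn (?nk k)) (?xk k)) \<le> enn2ereal (ennreal (sqrt c))"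
        using sl[of k] by (simp add: less_eq_ennreal.rep_eq)
      then show "enn2ereal (slope (Fn (?nk k)) (?xk k)) \<le> ereal (sqrt c)"
        using c by (simp add: enn2ereal_ennreal)
    qed
    then have "(SUP k. \<bar>Fn (?nk k) (?xk k)\<bar> + enn2ereal (slope (Fn (?nk k)) (?xk k))) \<le> ereal (K + sqrt c)"
      by (intro SUP_least) simp
    also have "\<dots> < \<infinity>"
      by simp
    finally have lim: "(\<lambda>k. Fn (?nk k) (?xk k)) \<longlonglongrightarrow> F (u \<tau>)"
      "slope F (u \<tau>) \<le> liminf (\<lambda>k. slope (Fn (?nk k)) (?xk k))"
      using assms(1)[OF filterlim_subseq[OF nk] xk] by auto
    have "(\<lambda>k. ereal (\<psi>n (?nk k) \<tau>)) \<longlonglongrightarrow> ereal (\<psi> \<tau>)"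
      using LIMSEQ_subseq_LIMSEQ[OF \<psi> q(1)] \<tau> by (auto simp: o_def intro: tendsto_ereal)
    then have "F (u \<tau>) = ereal (\<psi> \<tau>)"
      using lim(1) unfolding Feq by (intro LIMSEQ_unique)
    moreover have "slope F (u \<tau>) \<le> ennreal (sqrt c)"
      using lim(2) by (rule order_trans) (intro Liminf_le always_eventually allI sl sequentially_bot)
    then have "(slope F (u \<tau>))\<^sup>2 \<le> (ennreal (sqrt c))\<^sup>2"
      by (intro power_mono) auto
    then have "(slope F (u \<tau>))\<^sup>2 \<le> ennreal c"
      using c by (simp add: ennreal_power)
    ultimately show ?thesis ..
  qed
  have slope_le: "(slope F (u \<tau>))\<^sup>2 \<le> L \<tau>" if "\<tau> \<in> {0..T} - N" for \<tau>
  proof (rule dense_ge)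
    fix y assume "L \<tau> < y"
    then show "(slope F (u \<tau>))\<^sup>2 \<le> y"
      using point[OF that] by (cases y) auto
  qed

  \<comment> \<open>The exceptional null set\<close>
  have "upper_nn_integral (lebesgue_on {0<..<T}) L \<le> liminf (\<lambda>n. B (r n) 0 T)"
    unfolding B_def by (rule upper_nn_integral_Fatou) (simp add: L_def)
  also have "\<dots> \<le> ennreal (2 * (2 * K))"
    by (intro Liminf_le always_eventually allI bound sequentially_bot)
  also have "\<dots> < \<infinity>"
    by simp
  finally have "AE \<tau> in lebesgue_on {0<..<T}. L \<tau> < \<infinity>"
    by (rule AE_finite_of_upper_nn_integral)
  then have "AE \<tau> in lebesgue. \<tau> \<in> {0<..<T} \<longrightarrow> L \<tau> < \<infinity>"
    by (subst (asm) AE_restrict_space_iff) auto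
  then obtain N' where N': "N' \<in> null_sets lebesgue" "\<And>\<tau>. \<tau> \<in> {0<..<T} - N' \<Longrightarrow> L \<tau> < \<infinity>"
    by (rule AE_E3) auto
  \<comment> \<open>Finiteness of \<open>L\<close> is known only inside the open interval, so the
    endpoints are put into the exceptional set.\<close>
  define E where "E = {0..T} \<inter> ({0, T} \<union> N \<union> N')"
  have E: "E \<in> null_sets lebesgue"
  proof -
    have "{0, T} \<in> null_sets lebesgue"
      by (intro null_sets_completionI finite_imp_null_set_lborel) simp
    then have "{0, T} \<union> N \<union> N' \<in> null_sets lebesgue"
      using N N'(1) by auto
    then show ?thesis
      unfolding E_def by (intro null_set_Int1) auto
  qed

  \<comment> \<open>Regularity and energy inequality for the limit curve\<close>
  have AC_u: "u \<in> AC2 T"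
    and liminf_A: "\<And>a b. 0 \<le> a \<Longrightarrow> b \<le> T \<Longrightarrow>
      (\<integral>\<^sup>+\<tau>. ennreal ((metric_derivative T u \<tau>)\<^sup>2) \<partial>lebesgue_on {a<..<b}) \<le> liminf (\<lambda>n. A (r n) a b)"
    using AC2_limit[of T "\<lambda>n. un (r n)" "2 * (2 * K)" u] AC bound(1) ulim \<open>T > 0\<close>
    by (auto simp: A_def)
  have "maximal_slope_curve T F u \<psi> E"
    unfolding maximal_slope_curve_def
  proof (intro conjI allI impI ballI AC_u E)
    show "antimono_on {0..T} \<psi>"
    proof (rule monotone_onI)
      fix s t assume st: "s \<in> {0..T}" "t \<in> {0..T}" "s \<le> t"
      show "\<psi> t \<le> \<psi> s"
        using anti st by (intro LIMSEQ_le[OF \<psi>[OF st(2)] \<psi>[OF st(1)]]) (auto simp: monotone_on_def)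
    qed
    show "E \<subseteq> {0..T}"
      by (simp add: E_def)
  next
    fix t assume t: "t \<in> {0..T} - E"
    then have "L t < \<infinity>"
      by (intro N'(2)) (auto simp: E_def)
    then obtain m :: nat where "L t < of_nat m"
      using ennreal_Ex_less_of_nat[of "L t"] by auto
    then obtain c where "L t < ennreal c"
      using that[of "real m"] by (simp add: ennreal_of_nat_eq_real_of_nat)
    then show "ereal (\<psi> t) = F (u t)"
      using point[of t c] t by (auto simp: E_def)
  next
    fix s t assume "0 \<le> s \<and> s \<le> t \<and> t \<le> T"
    then have st: "0 \<le> s" "s \<le> t" "t \<le> T"
      by auto
    have "AE \<tau> in lebesgue. \<tau> \<notin> N"
      by (rule AE_not_in[OF N])
    then have "AE \<tau> in lebesgue_on {s<..<t}. (slope F (u \<tau>))\<^sup>2 \<le> L \<tau>"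
      using st slope_le by (subst AE_restrict_space_iff) (auto elim!: eventually_mono)
    then have "upper_nn_integral (lebesgue_on {s<..<t}) (\<lambda>\<tau>. (slope F (u \<tau>))\<^sup>2) \<le> liminf (\<lambda>n. B (r n) s t)"
      unfolding B_def L_def by (rule upper_nn_integral_Fatou)
    moreover have "(\<lambda>n. ennreal (\<psi>n (r n) s - \<psi>n (r n) t)) \<longlonglongrightarrow> ennreal (\<psi> s - \<psi> t)"
      using st by (intro tendsto_ennrealI tendsto_diff \<psi>) auto
    ultimately show "(\<integral>\<^sup>+\<tau>. ennreal ((metric_derivative T u \<tau>)\<^sup>2) \<partial>lebesgue_on {s<..<t}) / 2 +
        upper_nn_integral (lebesgue_on {s<..<t}) (\<lambda>\<tau>. (slope F (u \<tau>))\<^sup>2) / 2 \<le> ennreal (\<psi> s - \<psi> t)"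
      using st by (intro half_add_le_of_liminf[OF liminf_A _ energy]) auto
  qed
  then show ?thesis
    by blast
qed

end
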